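(* Let $F(\lambda)\in\mathbb C[\lambda]^{p\times p}$ be a matrix polynomial of nonzero degree whose highest column degree coefficient matrix $F_{\mathrm{hcdc}}$ is nonsingular and upper triangular, and whose sequence of Markov parameters $\mathscr S=(\mathbf s_k)_{k=0}^{l}$ is Hermitian, i.e. $\mathbf s_k=\mathbf s_k^*$ for $k=0,\ldots,l$. Let $\mathbf H_0^{\mathscr S}$ and $\mathbf H_1^{\mathscr S}$ be the associated rectangular block Hankel matrices (defined in the context). Then $F(\lambda)$ is Hurwitz stable if and only if $\mathbf H_0^{\mathscr S}$ and $\mathbf H_1^{\mathscr S}$ are both positive definite.
   Context: **Stability.** A regular matrix polynomial $F(\lambda)$ ($\det F\not\equiv0$) is Hurwitz stable if all its finite eigenvalues, i.e. all zeros of $\det F(\lambda)$ in $\mathbb C$, lie in the open left half-plane. **Column degrees.** For a regular $F=[f_1\ \cdots\ f_p]\in\mathbb C[\lambda]^{p\times p}$, $\mathrm{cdeg}_kF$ is the highest degree of the entries of the column $f_k$, and $\deg F=\max_k\mathrm{cdeg}_kF$. Write $F(\lambda)=A\,\mathrm{diag}(\lambda^{\mathrm{cdeg}_1F},\ldots,\lambda^{\mathrm{cdeg}_pF})+L(\lambda)$ with the $k$-th column of $L$ of degree $<\mathrm{cdeg}_kF$; then $F_{\mathrm{hcdc}}:=A$. $F$ is column reduced if $F_{\mathrm{hcdc}}$ is nonsingular. **Dominant and subordinated parts.** Let $F$ be column reduced with $\deg F\in\{2m,2m+1\}$, $\deg F\ge1$. Write each column uniquely as $f_k(\lambda)=f_{k,e}(\lambda^2)+\lambda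 f_{k,o}(\lambda^2)$ with vector polynomials $f_{k,e},f_{k,o}$. If $\mathrm{cdeg}_kF$ is even put $d_k(\lambda)=f_{k,e}(\lambda)$, $s_k(\lambda)=\lambda f_{k,o}(\lambda)$; if $\mathrm{cdeg}_kF$ is odd put $d_k(\lambda)=f_{k,o}(\lambda)$, $s_k(\lambda)=f_{k,e}(\lambda)$. Set $F_d=[d_1\ \cdots\ d_p]$, $F_s=[s_1\ \cdots\ s_p]$. Then $\deg F_d=m$ and $(F_d)_{\mathrm{hcdc}}=F_{\mathrm{hcdc}}$. **Markov parameters.** The rational matrix $R_F(\lambda)=F_s(\lambda)F_d(\lambda)^{-1}$ has a finite limit at $\infty$ and expands as $R_F(\lambda)=\sum_{k\ge0}(-1)^k\lambda^{-k}\mathbf s_k$ as $\lambda\to\infty$. Put $l=2m-1$ if all column degrees of $F$ are even and $l=2m$ otherwise. The sequence of Markov parameters of $F$ is $\mathscr S=(\mathbf s_k)_{k=0}^{l}$. **Block Hankel matrices.** For a matrix $A$ and index sets $\mathcal I,\mathcal J$, $A_{\mathcal I}^{\mathcal J}$ is the submatrix formed by the rows with indices in $\mathcal I$ and the columns with indices in $\mathcal J$ (in increasing order). For $i=-1,0,\ldots,m$ let $\mathcal I_i=\{k: \mathrm{cdeg}_kF_d>i\}$, $\mathcal I_i^e=\{k\in\mathcal I_i:\mathrm{cdeg}_kF\text{ even}\}$, $\mathcal I_i^o=\{k\in\mathcal I_i:\mathrm{cdeg}_kF\text{ odd}\}$, and for $i=0,\ldots,m$ let $\widetilde{\mathcal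 I}_i=\mathcal I_i^e\cup\mathcal I_{i-1}^o$. Set $\widetilde{\mathbf h}_{i,j}=(\mathbf s_{i+j})_{\widetilde{\mathcal I}_i}^{\widetilde{\mathcal I}_j}$ and $\mathbf h_{i,j}=(\mathbf s_{i+j+1})_{\mathcal I_i}^{\mathcal I_j}$. Then $\mathbf H_1^{\mathscr S}=(\mathbf h_{i,j})_{i,j=0}^{m-1}$ (empty if $m=0$), while $\mathbf H_0^{\mathscr S}=(\widetilde{\mathbf h}_{i,j})_{i,j=0}^{m-1}$ if all column degrees of $F$ are even and $\mathbf H_0^{\mathscr S}=(\widetilde{\mathbf h}_{i,j})_{i,j=0}^{m}$ if at least one column degree of $F$ is odd. Blocks with an empty index set are empty; an empty matrix counts as positive definite. *)

theory Defs
  imports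
    "HOL-Complex_Analysis.Laurent_Convergence"
    "Jordan_Normal_Form.Determinant"
    "Jordan_Normal_Form.Gauss_Jordan_Elimination"
    "Jordan_Normal_Form.Schur_Decomposition"
    "Jordan_Normal_Form.DL_Submatrix"
begin

text \<open>Matrix polynomials are matrices with entries in \<^typ>\<open>complex poly\<close>. Rows, columns and the
  index sets below are numbered from \<open>0\<close>.\<close>

hide_const (open) Determinants.det Finite_Cartesian_Product.vec Finite_Cartesian_Product.mat
  Finite_Cartesian_Product.row Finite_Cartesian_Product.column Finite_Cartesian_Product.transpose
  Finite_Cartesian_Product.rows Finite_Cartesian_Product.columns
no_notation Finite_Cartesian_Product.vec_nth (infixl \<open>$\<close> 90)

type_synonym mat_poly = "complex poly mat"

section \<open>Column degrees, column reducedness, stability\<close>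

definition cdeg :: "mat_poly \<Rightarrow> nat \<Rightarrow> nat" where
  "cdeg F k = Max {Polynomial.degree (F $$ (i, k)) | i. i < dim_row F}"

definition mdeg :: "mat_poly \<Rightarrow> nat" where
  "mdeg F = Max {cdeg F k | k. k < dim_col F}"

definition hcdc :: "mat_poly \<Rightarrow> complex mat" where
  "hcdc F = mat (dim_row F) (dim_col F) (\<lambda>(i, k). Polynomial.coeff (F $$ (i, k)) (cdeg F k))"

text \<open>Every column of \<open>F\<close> is its \<open>hcdc\<close> column times \<open>\<lambda>\<close> to the column degree, plus a remainder of
  lower degree. (In a constant column the remainder is \<open>0\<close>.)\<close>

lemma hcdc_remainder:
  assumes "i < dim_row F" "k < dim_col F" "cdeg F k \<le> n"
  shows "Polynomial.coeff (F $$ (i, k) - Polynomial.monom (hcdc F $$ (i, k)) (cdeg F k)) n = 0"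
proof -
  have "Polynomial.degree (F $$ (i, k)) \<le> cdeg F k"
    unfolding cdeg_def using assms(1) by (intro Max_ge) auto
  then show ?thesis
    using assms by (cases "n = cdeg F k") (auto simp: hcdc_def coeff_eq_0)
qed

definition regular :: "mat_poly \<Rightarrow> bool" where
  "regular F \<longleftrightarrow> square_mat F \<and> Determinant.det F \<noteq> 0"

definition column_reduced :: "mat_poly \<Rightarrow> bool" where
  "column_reduced F \<longleftrightarrow> square_mat F \<and> Determinant.det (hcdc F) \<noteq> 0"

definition hurwitz_stable :: "mat_poly \<Rightarrow> bool" where
  "hurwitz_stable F \<longleftrightarrow> regular F \<and> (\<forall>z. poly (Determinant.det F) z = 0 \<longrightarrow> Re z < 0)"

section \<open>Dominant and subordinated parts\<close>

definition even_part :: "complex poly \<Rightarrow> complex poly" where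
  "even_part f = (\<Sum>n\<le>Polynomial.degree f. Polynomial.monom (Polynomial.coeff f (2 * n)) n)"

definition odd_part :: "complex poly \<Rightarrow> complex poly" where
  "odd_part f = (\<Sum>n\<le>Polynomial.degree f. Polynomial.monom (Polynomial.coeff f (2 * n + 1)) n)"

lemma coeff_even_part: "Polynomial.coeff (even_part f) n = Polynomial.coeff f (2 * n)"
  by (cases "n \<le> Polynomial.degree f") (auto simp: even_part_def coeff_sum coeff_eq_0)

lemma coeff_odd_part: "Polynomial.coeff (odd_part f) n = Polynomial.coeff f (2 * n + 1)"
  by (cases "n \<le> Polynomial.degree f") (auto simp: odd_part_def coeff_sum coeff_eq_0)

lemma coeff_pcompose_square:
  "Polynomial.coeff (pcompose g (Polynomial.monom (1 :: complex) 2)) n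
    = (if even n then Polynomial.coeff g (n div 2) else 0)"
proof (induction g arbitrary: n)
  case (pCons a g)
  have "n div 2 = Suc ((n - 2) div 2)" "even (n - 2) \<longleftrightarrow> even n" if "n \<ge> 2"
    using that by (auto simp: le_div_geq)
  moreover have "n = 0 \<or> n = 1 \<or> n \<ge> 2" by linarith
  ultimately show ?case
    by (auto simp: pcompose_pCons coeff_monom_mult coeff_pCons pCons.IH split: nat.splits)
qed simp

text \<open>Existence and uniqueness of the decomposition of \<open>f\<close> into even and odd part.\<close>

lemma even_odd_decomposition:
  "f = pcompose g (Polynomial.monom 1 2) + [:0, 1:] * pcompose h (Polynomial.monom 1 2)
    \<longleftrightarrow> g = even_part f \<and> h = odd_part f"
proof -
  let ?C = "pcompose g (Polynomial.monom 1 2) + [:0, 1:] * pcompose h (Polynomial.monom 1 2)"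
  have e: "Polynomial.coeff ?C (2 * n) = Polynomial.coeff g n" for n
    by (cases n) (auto simp: coeff_pcompose_square coeff_pCons simp del: coeff_pcompose_0)
  have o: "Polynomial.coeff ?C (2 * n + 1) = Polynomial.coeff h n" for n
    by (auto simp: coeff_pcompose_square coeff_pCons simp del: coeff_pcompose_0)
  show ?thesis
  proof
    assume "f = ?C"
    then show "g = even_part f \<and> h = odd_part f"
      using e o by (auto simp: poly_eq_iff coeff_even_part coeff_odd_part)
  next
    assume "g = even_part f \<and> h = odd_part f"
    then have "Polynomial.coeff f n = Polynomial.coeff ?C n" for n
      using e[of "n div 2"] o[of "n div 2"]
      by (cases "even n") (auto simp: coeff_even_part coeff_odd_part elim!: evenE oddE)
    then show "f = ?C" by (simp add: poly_eq_iff)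
  qed
qed

definition dominant_part :: "mat_poly \<Rightarrow> mat_poly" where
  "dominant_part F = mat (dim_row F) (dim_col F) (\<lambda>(i, k).
     if even (cdeg F k) then even_part (F $$ (i, k)) else odd_part (F $$ (i, k)))"

definition subordinated_part :: "mat_poly \<Rightarrow> mat_poly" where
  "subordinated_part F = mat (dim_row F) (dim_col F) (\<lambda>(i, k).
     if even (cdeg F k) then [:0, 1:] * odd_part (F $$ (i, k)) else even_part (F $$ (i, k)))"

section \<open>Markov parameters\<close>

definition eval_mat_poly :: "mat_poly \<Rightarrow> complex \<Rightarrow> complex mat" where
  "eval_mat_poly F z = map_mat (\<lambda>f. poly f z) F"

text \<open>The rational matrix \<open>R\<^sub>F\<close>, as a function of \<open>z\<close>; meaningful away from the finitely many zeros
  of the determinant of the dominant part, where \<^const>\<open>mat_inverse\<close> is \<^term>\<open>None\<close>.\<close>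

definition rational_matrix :: "mat_poly \<Rightarrow> complex \<Rightarrow> complex mat" where
  "rational_matrix F z =
     eval_mat_poly (subordinated_part F) z * the (mat_inverse (eval_mat_poly (dominant_part F) z))"

text \<open>The expansion of \<open>R\<^sub>F\<close> at infinity is the Laurent expansion of \<open>R\<^sub>F(1/w)\<close> at \<open>w = 0\<close>: the
  coefficient of \<open>\<lambda>\<close> to the power \<open>-k\<close> in the former is that of \<open>w\<close> to the power \<open>k\<close> in the latter.
  By definition it equals \<open>(-1)\<^sup>k\<close> times the \<open>k\<close>-th Markov parameter.\<close>

definition markov :: "mat_poly \<Rightarrow> nat \<Rightarrow> complex mat" where
  "markov F k = mat (dim_row F) (dim_row F) (\<lambda>(i, j).
     (-1) ^ k * fls_nth (laurent_expansion (\<lambda>w. rational_matrix F (1 / w) $$ (i, j)) 0) (int k))"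

definition all_cdeg_even :: "mat_poly \<Rightarrow> bool" where
  "all_cdeg_even F \<longleftrightarrow> (\<forall>k<dim_col F. even (cdeg F k))"

definition half_deg :: "mat_poly \<Rightarrow> nat" where
  "half_deg F = mdeg F div 2"

text \<open>The last index \<open>l\<close>. If all column degrees are even and \<open>F\<close> has nonzero degree then
  \<^term>\<open>half_deg F\<close> is positive, so the subtraction does not truncate.\<close>

definition markov_last :: "mat_poly \<Rightarrow> nat" where
  "markov_last F = (if all_cdeg_even F then 2 * half_deg F - 1 else 2 * half_deg F)"

section \<open>Block Hankel matrices\<close>

definition index_set :: "mat_poly \<Rightarrow> int \<Rightarrow> nat set" where
  "index_set F i = {k. k < dim_col F \<and> int (cdeg (dominant_part F) k) > i}"

definition index_set_tilde :: "mat_poly \<Rightarrow> nat \<Rightarrow> nat set" where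
  "index_set_tilde F i =
     {k \<in> index_set F (int i). even (cdeg F k)} \<union> {k \<in> index_set F (int i - 1). odd (cdeg F k)}"

text \<open>The matrix with \<open>n\<close> times \<open>n\<close> blocks \<open>B i j\<close>, where the number of rows of \<open>B i j\<close> depends only
  on \<open>i\<close> and the number of columns only on \<open>j\<close>. The list \<open>block_indices n r\<close> enumerates the pairs
  (block, position inside the block) for \<open>n\<close> consecutive blocks of sizes \<open>r 0, r 1, \<dots>\<close>.\<close>

definition block_indices :: "nat \<Rightarrow> (nat \<Rightarrow> nat) \<Rightarrow> (nat \<times> nat) list" where
  "block_indices n r = concat (map (\<lambda>i. map (\<lambda>u. (i, u)) [0..<r i]) [0..<n])"

definition block_mat :: "nat \<Rightarrow> (nat \<Rightarrow> nat \<Rightarrow> 'a mat) \<Rightarrow> 'a mat" where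
  "block_mat n B =
     (let rs = block_indices n (\<lambda>i. dim_row (B i 0));
          cs = block_indices n (\<lambda>j. dim_col (B 0 j))
      in mat (length rs) (length cs) (\<lambda>(a, b).
           B (fst (rs ! a)) (fst (cs ! b)) $$ (snd (rs ! a), snd (cs ! b))))"

definition hankel_0 :: "mat_poly \<Rightarrow> complex mat" where
  "hankel_0 F = block_mat (if all_cdeg_even F then half_deg F else half_deg F + 1)
     (\<lambda>i j. submatrix (markov F (i + j)) (index_set_tilde F i) (index_set_tilde F j))"

definition hankel_1 :: "mat_poly \<Rightarrow> complex mat" where
  "hankel_1 F = block_mat (half_deg F)
     (\<lambda>i j. submatrix (markov F (i + j + 1)) (index_set F (int i)) (index_set F (int j)))"

section \<open>Hermitian and positive definite matrices\<close>

definition hermitian :: "complex mat \<Rightarrow> bool" where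
  "hermitian A \<longleftrightarrow> mat_adjoint A = A"

text \<open>In the order on the complex numbers, \<open>0 < z\<close> means that \<open>z\<close> is real and positive. The
  condition is vacuous for the empty matrix.\<close>

definition positive_definite :: "complex mat \<Rightarrow> bool" where
  "positive_definite A \<longleftrightarrow> square_mat A \<and> hermitian A \<and>
     (\<forall>v \<in> carrier_vec (dim_row A). v \<noteq> 0\<^sub>v (dim_row A) \<longrightarrow> 0 < (A *\<^sub>v v) \<bullet>c v)"

end

theory Submission
  imports Defs "Jordan_Normal_Form.Spectral_Radius"
begin

text \<open>Write \<open>F = D + S\<close>, where column \<open>k\<close> of \<open>D\<close> collects the powers of \<open>\<lambda>\<close> that have the parity
  of the column degree, so that \<open>W = S D\<^sup>-\<^sup>1\<close> equals \<open>R\<^sub>F(\<lambda>\<^sup>2) / \<lambda>\<close>. With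
  \<open>u\<^sup>*(\<lambda>)\<close> the conjugate transpose of \<open>u(-\<lambda>)\<close> for real \<open>\<lambda>\<close>, let \<open>P(u, v)\<close> be the coefficient of
  \<open>1/\<lambda>\<close> in \<open>u\<^sup>* W v\<close>. The Hermitian Markov parameters make \<open>P\<close> a Hermitian form on vector
  polynomials whose kernel contains all \<open>D q\<close>. Since the leading coefficient matrix is triangular, the
  vector polynomials \<open>u\<close> with \<open>deg u\<^sub>k\<close> below the \<open>k\<close>-th column degree represent the quotient by these,
  and splitting \<open>u\<close> into even and odd part turns \<open>P\<close> into the direct sum of the two block Hankel
  forms. On the quotient, multiplication by \<open>\<lambda>\<close> is skew with respect to \<open>P\<close>, and the operator
  \<open>u \<mapsto> \<lambda> u - C u\<close>, where \<open>C u\<close> is the coefficient of \<open>1/\<lambda>\<close> in \<open>W u\<close>, has the zeros of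
  \<open>det F\<close> as eigenvalues and decreases \<open>P\<close> at the rate \<open>2 \<bar>C u\<bar>\<^sup>2\<close>. So the theorem is
  Lyapunov's theorem for this operator.\<close>

text \<open>The dissipation 2|C u|^2 can vanish on nonzero classes, so the strict form of Lyapunov's
  theorem fits neither direction. If P is definite, an eigenvector u for an eigenvalue with
  nonnegative real part has C u = 0; then C(f u) = 0 for every polynomial f, so P(u, u) = 0, a
  contradiction. Conversely, stability gives only P >= 0, and a kernel must be excluded separately.
  Here the splitting by parity enters: up to signs of the columns, F(\<lambda>) and F(-\<lambda>)
  differ only in the sign of S.

  The other obstacle is that only s_0, ..., s_l are known to be Hermitian, while multiplication by
  \<lambda> leaves every bounded range of degrees. Since all column degrees are at most l + 1, the
  product of a column of D and a remainder has degree at most 2l + 1, and as W is odd, P involves no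
  Markov parameter beyond s_l there. The vanishing of P on the columns then settles all higher
  degrees.\<close>

hide_const (open) module.smult
no_notation fps_nth (infixl \<open>$\<close> 75)
  and fls_nth (infixl \<open>$$\<close> 75)

section \<open>Lyapunov's theorem\<close>

definition gram_form :: "nat \<Rightarrow> (nat \<Rightarrow> nat \<Rightarrow> complex) \<Rightarrow> complex vec \<Rightarrow> complex vec \<Rightarrow> complex" where
  "gram_form n B x y = (\<Sum>a<n. \<Sum>b<n. cnj (x $ a) * B a b * y $ b)"

lemma gram_form_add_left:
  "x \<in> carrier_vec n \<Longrightarrow> x' \<in> carrier_vec n \<Longrightarrow>
    gram_form n B (x + x') y = gram_form n B x y + gram_form n B x' y"
  by (simp add: gram_form_def algebra_simps sum.distrib)

lemma gram_form_add_right: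
  "y \<in> carrier_vec n \<Longrightarrow> y' \<in> carrier_vec n \<Longrightarrow>
    gram_form n B x (y + y') = gram_form n B x y + gram_form n B x y'"
  by (simp add: gram_form_def algebra_simps sum.distrib)

lemma gram_form_smult_left:
  "x \<in> carrier_vec n \<Longrightarrow> gram_form n B (c \<cdot>\<^sub>v x) y = cnj c * gram_form n B x y"
  by (simp add: gram_form_def sum_distrib_left mult.assoc)

lemma gram_form_smult_right:
  "y \<in> carrier_vec n \<Longrightarrow> gram_form n B x (c \<cdot>\<^sub>v y) = c * gram_form n B x y"
  by (simp add: gram_form_def sum_distrib_left mult_ac)

lemma gram_form_swap:
  assumes "\<And>a b. a < n \<Longrightarrow> b < n \<Longrightarrow> B b a = cnj (B a b)"
  shows "gram_form n B y x = cnj (gram_form n B x y)"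
proof -
  have "gram_form n B y x = (\<Sum>b<n. \<Sum>a<n. cnj (y $ a) * B a b * x $ b)"
    unfolding gram_form_def by (rule sum.swap)
  also have "\<dots> = (\<Sum>b<n. \<Sum>a<n. cnj (cnj (x $ b) * B b a * y $ a))"
  proof (intro sum.cong refl)
    fix a b assume "b \<in> {..<n}" "a \<in> {..<n}"
    then have "B a b = cnj (B b a)" by (intro assms) simp_all
    then show "cnj (y $ a) * B a b * x $ b = cnj (cnj (x $ b) * B b a * y $ a)"
      by simp
  qed
  finally show ?thesis by (simp add: gram_form_def)
qed

lemma norm_gram_form_le:
  assumes "\<And>a. a < n \<Longrightarrow> norm (x $ a) \<le> r" "r \<ge> 0"
  shows "norm (gram_form n B x x) \<le> (\<Sum>a<n. \<Sum>b<n. norm (B a b)) * r\<^sup>2"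
proof -
  have "norm (cnj (x $ a) * B a b * x $ b) \<le> norm (B a b) * r\<^sup>2" if "a < n" "b < n" for a b
  proof -
    have "norm (x $ a) * norm (x $ b) \<le> r * r"
      using assms(1)[of a] assms(1)[of b] assms(2) that by (intro mult_mono) auto
    then have "norm (B a b) * (norm (x $ a) * norm (x $ b)) \<le> norm (B a b) * (r * r)"
      by (rule mult_left_mono) simp
    then show ?thesis
      unfolding norm_mult complex_mod_cnj power2_eq_square by (simp only: mult_ac)
  qed
  then have "norm (gram_form n B x x) \<le> (\<Sum>a<n. \<Sum>b<n. norm (B a b) * r\<^sup>2)"
    unfolding gram_form_def by (intro sum_norm_le) auto
  then show ?thesis
    by (simp add: sum_distrib_right)
qed

text \<open>Powers of a matrix with spectral radius below 1 are bounded. Applied to M/\<rho>, with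
  \<rho> halfway between the spectral radius of M and 1, this becomes geometric decay of the powers
  of M. The empty matrix is treated apart because its spectrum has no maximum.\<close>

lemma power_mat_norm_bound:
  fixes M :: "complex mat"
  assumes M: "M \<in> carrier_mat n n"
    and ev: "\<And>\<nu> v. v \<in> carrier_vec n \<Longrightarrow> v \<noteq> 0\<^sub>v n \<Longrightarrow> M *\<^sub>v v = \<nu> \<cdot>\<^sub>v v \<Longrightarrow> norm \<nu> < 1"
  shows "\<exists>c \<rho>. 0 \<le> c \<and> 0 < \<rho> \<and> \<rho> < 1 \<and> (\<forall>k. norm_bound (M ^\<^sub>m k) (c * \<rho> ^ k))"
proof (cases "n = 0")
  case True
  then have "norm_bound (M ^\<^sub>m k) (0 * (1/2) ^ k)" for k
    using M by (auto simp: norm_bound_def)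
  then show ?thesis
    by (intro exI[of _ 0] exI[of _ "1/2"]) auto
next
  case False
  then have n: "0 < n" by simp
  define s where "s = spectral_radius M"
  have "s \<in> norm ` spectrum M"
    using spectral_radius_mem_max[OF M n] by (simp add: s_def)
  then have s: "0 \<le> s" "s < 1"
    using ev M by (auto simp: spectrum_def eigenvalue_def eigenvector_def)
  define \<rho> where "\<rho> = (s + 1) / 2"
  have \<rho>: "0 < \<rho>" "\<rho> < 1" "s < \<rho>"
    using s by (auto simp: \<rho>_def)
  define M' where "M' = complex_of_real (1 / \<rho>) \<cdot>\<^sub>m M"
  have M': "M' \<in> carrier_mat n n"
    using M by (simp add: M'_def)
  have pow: "M ^\<^sub>m k = complex_of_real (\<rho> ^ k) \<cdot>\<^sub>m M' ^\<^sub>m k" for k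
  proof (induction k)
    case 0
    then show ?case using M M' by (auto intro!: eq_matI)
  next
    case (Suc k)
    have "M = complex_of_real \<rho> \<cdot>\<^sub>m M'"
      using M \<rho> by (intro eq_matI) (auto simp: M'_def)
    then have "M ^\<^sub>m Suc k = (complex_of_real (\<rho> ^ k) \<cdot>\<^sub>m M' ^\<^sub>m k) * (complex_of_real \<rho> \<cdot>\<^sub>m M')"
      using Suc by simp
    also have "\<dots> = complex_of_real (\<rho> ^ Suc k) \<cdot>\<^sub>m (M' ^\<^sub>m k * M')"
      using M' pow_carrier_mat[OF M', of k]
      by (intro eq_matI) (auto simp: mult_smult_assoc_mat mult_smult_distrib mult_ac)
    finally show ?case by simp
  qed
  have "spectral_radius M' \<in> norm ` spectrum M'"
    using spectral_radius_mem_max[OF M' n] by simp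
  then obtain \<nu> v where \<nu>: "spectral_radius M' = norm \<nu>" "v \<in> carrier_vec n" "v \<noteq> 0\<^sub>v n" "M' *\<^sub>v v = \<nu> \<cdot>\<^sub>v v"
    using M' by (auto simp: spectrum_def eigenvalue_def eigenvector_def)
  have "M *\<^sub>v v = (complex_of_real \<rho> * \<nu>) \<cdot>\<^sub>v v"
  proof -
    have "M = complex_of_real \<rho> \<cdot>\<^sub>m M'"
      using M \<rho> by (intro eq_matI) (auto simp: M'_def)
    then have "M *\<^sub>v v = complex_of_real \<rho> \<cdot>\<^sub>v (M' *\<^sub>v v)"
      using M' \<nu>(2) by (auto intro!: eq_vecI simp: scalar_prod_def sum_distrib_left mult_ac)
    then show ?thesis by (simp add: \<nu>(4) smult_smult_assoc)
  qed
  then have "complex_of_real \<rho> * \<nu> \<in> spectrum M"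
    using \<nu>(2,3) M by (auto simp: spectrum_def eigenvalue_def eigenvector_def)
  then have "norm (complex_of_real \<rho> * \<nu>) \<in> norm ` spectrum M"
    by (rule imageI)
  then have "\<rho> * norm \<nu> \<le> s"
    using spectral_radius_mem_max(2)[OF M n] \<rho> by (simp add: s_def norm_mult)
  then have "\<rho> * norm \<nu> < \<rho> * 1" using \<rho> by linarith
  then have "spectral_radius M' < 1"
    using \<rho> \<nu>(1) mult_less_cancel_left_pos by metis
  then obtain c where c: "\<And>k. norm_bound (M' ^\<^sub>m k) c"
    using spectral_radius_jnf_norm_bound_less_1_upper_triangular[OF M'] by blast
  have "norm_bound (M ^\<^sub>m k) (max c 0 * \<rho> ^ k)" for k
    unfolding norm_bound_def
  proof (intro allI impI)
    fix i j assume ij: "i < dim_row (M ^\<^sub>m k)" "j < dim_col (M ^\<^sub>m k)"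
    then have ij': "i < n" "j < n" using pow_carrier_mat[OF M, of k] by (simp_all only: carrier_matD)
    have "norm ((M' ^\<^sub>m k) $$ (i, j)) \<le> c"
      using c[of k] ij' M' by (auto simp: norm_bound_def)
    then have "norm ((M' ^\<^sub>m k) $$ (i, j)) * \<rho> ^ k \<le> max c 0 * \<rho> ^ k"
      using \<rho> by (intro mult_right_mono) auto
    then show "norm ((M ^\<^sub>m k) $$ (i, j)) \<le> max c 0 * \<rho> ^ k"
      using ij' M' \<rho> by (simp add: pow norm_mult norm_power mult_ac)
  qed
  then show ?thesis using \<rho> by (intro exI[of _ "max c 0"] exI[of _ \<rho>]) auto
qed

text \<open>The Cayley transform \<open>(A + 1) (A - 1)\<^sup>-\<^sup>1\<close> does not increase the form, and its powers tend to \<open>0\<close>.\<close>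

lemma lyapunov_nonneg:
  fixes A :: "complex mat"
  assumes A: "A \<in> carrier_mat n n"
    and ev: "\<And>\<alpha> v. v \<in> carrier_vec n \<Longrightarrow> v \<noteq> 0\<^sub>v n \<Longrightarrow> A *\<^sub>v v = \<alpha> \<cdot>\<^sub>v v \<Longrightarrow> Re \<alpha> < 0"
    and B: "\<And>a b. a < n \<Longrightarrow> b < n \<Longrightarrow> B b a = cnj (B a b)"
    and dissipative: "\<And>v. v \<in> carrier_vec n \<Longrightarrow> Re (gram_form n B v (A *\<^sub>v v)) \<le> 0"
    and u: "u \<in> carrier_vec n"
  shows "0 \<le> Re (gram_form n B u u)"
proof -
  define Q where "Q x = Re (gram_form n B x x)" for x
  define A1 where "A1 = A - 1\<^sub>m n"
  define A2 where "A2 = A + 1\<^sub>m n"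
  have A12: "A1 \<in> carrier_mat n n" "A2 \<in> carrier_mat n n"
    using A by (auto simp: A1_def A2_def)
  have A1v: "A1 *\<^sub>v v = A *\<^sub>v v - v" and A2v: "A2 *\<^sub>v v = A *\<^sub>v v + v" if "v \<in> carrier_vec n" for v
    using that A by (auto simp: A1_def A2_def minus_mult_distrib_mat_vec add_mult_distrib_mat_vec)
  have "Determinant.det A1 \<noteq> 0"
  proof
    assume "Determinant.det A1 = 0"
    then obtain v where v: "v \<in> carrier_vec n" "v \<noteq> 0\<^sub>v n" "A1 *\<^sub>v v = 0\<^sub>v n"
      using det_0_iff_vec_prod_zero[OF A12(1)] by auto
    have "A *\<^sub>v v = 1 \<cdot>\<^sub>v v"
    proof (intro eq_vecI)
      fix i assume i: "i < dim_vec (1 \<cdot>\<^sub>v v)"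
      have "(A *\<^sub>v v - v) $ i = 0"
        using v(3) A1v[OF v(1)] i v(1) by simp
      then show "(A *\<^sub>v v) $ i = (1 \<cdot>\<^sub>v v) $ i"
        using i v(1) A by simp
    qed (use A v in auto)
    from ev[OF v(1,2) this] show False by simp
  qed
  then have "A1 \<in> Units (ring_mat TYPE(complex) n ())"
    by (rule det_non_zero_imp_unit[OF A12(1)])
  then obtain X where X: "X \<in> carrier_mat n n" "A1 * X = 1\<^sub>m n"
    by (auto simp: Units_def ring_mat_def)
  define M where "M = A2 * X"
  have M: "M \<in> carrier_mat n n"
    using A12 X by (simp add: M_def)
  have Mv: "\<exists>v \<in> carrier_vec n. x = A *\<^sub>v v - v \<and> M *\<^sub>v x = A *\<^sub>v v + v" if x: "x \<in> carrier_vec n" for x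
  proof (intro bexI[of _ "X *\<^sub>v x"] conjI)
    have Xx: "X *\<^sub>v x \<in> carrier_vec n" using X x by simp
    show "x = A *\<^sub>v (X *\<^sub>v x) - X *\<^sub>v x"
      using A1v[OF Xx] assoc_mult_mat_vec[OF A12(1) X(1) x] X x by simp
    show "M *\<^sub>v x = A *\<^sub>v (X *\<^sub>v x) + X *\<^sub>v x"
      using A2v[OF Xx] assoc_mult_mat_vec[OF A12(2) X(1) x] by (simp add: M_def)
    show "X *\<^sub>v x \<in> carrier_vec n" by (rule Xx)
  qed
  \<comment> \<open>The Cayley map is an involution: an eigenvalue \<nu> of \<open>M\<close> comes
    from the eigenvalue (\<nu> + 1)/(\<nu> - 1) of \<open>A\<close>, whose real part has the sign of
    |\<nu>|^2 - 1.\<close>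
  have "norm \<nu> < 1" if x: "x \<in> carrier_vec n" "x \<noteq> 0\<^sub>v n" "M *\<^sub>v x = \<nu> \<cdot>\<^sub>v x" for \<nu> x
  proof -
    obtain v where v: "v \<in> carrier_vec n" "x = A *\<^sub>v v - v" "M *\<^sub>v x = A *\<^sub>v v + v"
      using Mv[OF x(1)] by blast
    have Av: "A *\<^sub>v v \<in> carrier_vec n" using A v by simp
    have eq: "(\<nu> - 1) * (A *\<^sub>v v) $ i = (\<nu> + 1) * v $ i" if "i < n" for i
    proof -
      have "(A *\<^sub>v v + v) $ i = (\<nu> \<cdot>\<^sub>v (A *\<^sub>v v - v)) $ i"
        using x(3) v by simp
      then show ?thesis using that v(1) Av by (simp add: algebra_simps)
    qed
    have v0: "v \<noteq> 0\<^sub>v n"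
    proof
      assume "v = 0\<^sub>v n"
      then have "x = 0\<^sub>v n" using v(2) A by (auto intro!: eq_vecI)
      then show False using x(2) by simp
    qed
    have \<nu>1: "\<nu> \<noteq> 1"
    proof
      assume "\<nu> = 1"
      then have "v = 0\<^sub>v n" using eq v(1) by (intro eq_vecI) auto
      then show False using v0 by simp
    qed
    have "A *\<^sub>v v = ((\<nu> + 1) / (\<nu> - 1)) \<cdot>\<^sub>v v"
    proof (intro eq_vecI)
      fix i assume "i < dim_vec (((\<nu> + 1) / (\<nu> - 1)) \<cdot>\<^sub>v v)"
      then have i: "i < n" using v(1) by simp
      then have "(A *\<^sub>v v) $ i = (\<nu> + 1) * v $ i / (\<nu> - 1)"
        using eq[OF i] \<nu>1 by (simp add: nonzero_eq_divide_eq mult_ac)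
      then show "(A *\<^sub>v v) $ i = (((\<nu> + 1) / (\<nu> - 1)) \<cdot>\<^sub>v v) $ i"
        using i v(1) by simp
    qed (use v(1) A in auto)
    from ev[OF v(1) v0 this] have "Re ((\<nu> + 1) / (\<nu> - 1)) < 0" .
    then have "Re ((\<nu> + 1) * cnj (\<nu> - 1)) < 0"
      using \<nu>1 by (simp add: Re_complex_div_lt_0)
    then have "Re \<nu> * Re \<nu> + Im \<nu> * Im \<nu> < 1"
      by (simp add: algebra_simps)
    then have "(norm \<nu>)\<^sup>2 < 1\<^sup>2"
      unfolding cmod_power2 by (simp add: power2_eq_square)
    then show "norm \<nu> < 1"
      by (rule power_less_imp_less_base) simp
  qed
  then obtain c \<rho> where c: "0 \<le> c" "0 < \<rho>" "\<rho> < 1" "\<And>k. norm_bound (M ^\<^sub>m k) (c * \<rho> ^ k)"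
    using power_mat_norm_bound[OF M] by blast
  have swap: "gram_form n B y x = cnj (gram_form n B x y)" for x y
    using gram_form_swap[of n B] B by blast
  \<comment> \<open>Polarization: with y = A v, the form at y + v minus the form at y - v has real
    part 4 Re B(v, A v).\<close>
  have step: "Q (M *\<^sub>v x) \<le> Q x" if x: "x \<in> carrier_vec n" for x
  proof -
    obtain v where v: "v \<in> carrier_vec n" "x = A *\<^sub>v v - v" "M *\<^sub>v x = A *\<^sub>v v + v"
      using Mv[OF x(1)] by blast
    define y where "y = A *\<^sub>v v"
    define v' where "v' = (-1) \<cdot>\<^sub>v v"
    have y: "y \<in> carrier_vec n" "v' \<in> carrier_vec n" using A v by (auto simp: y_def v'_def)
    have x': "x = y + v'" using v y by (auto simp: y_def v'_def intro!: eq_vecI)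
    have s: "Re (gram_form n B y v) = Re (gram_form n B v y)"
      using swap[of y v] by simp
    have "gram_form n B x x = gram_form n B y y - gram_form n B y v - gram_form n B v y + gram_form n B v v"
      unfolding x' using y v(1)
      by (simp add: gram_form_add_left gram_form_add_right)
         (simp add: v'_def gram_form_smult_left gram_form_smult_right)
    moreover have "gram_form n B (M *\<^sub>v x) (M *\<^sub>v x)
        = gram_form n B y y + gram_form n B y v + gram_form n B v y + gram_form n B v v"
      unfolding v(3) y_def[symmetric] using y v(1)
      by (simp add: gram_form_add_left gram_form_add_right)
    ultimately have "Q (M *\<^sub>v x) - Q x = 4 * Re (gram_form n B v y)"
      using s by (simp add: Q_def)
    then show ?thesis using dissipative[OF v(1)] by (simp add: y_def)
  qed
  have pow: "M ^\<^sub>m k *\<^sub>v u \<in> carrier_vec n \<and> Q (M ^\<^sub>m k *\<^sub>v u) \<le> Q u" for k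
  proof (induction k)
    case 0
    then show ?case using M u by simp
  next
    case (Suc k)
    have "M ^\<^sub>m Suc k = M * M ^\<^sub>m k"
      using M by (induction k) (auto simp: assoc_mult_mat[where n\<^sub>1 = n and n\<^sub>2 = n and n\<^sub>3 = n and n\<^sub>4 = n])
    then have eq: "M ^\<^sub>m Suc k *\<^sub>v u = M *\<^sub>v (M ^\<^sub>m k *\<^sub>v u)"
      using assoc_mult_mat_vec[OF M pow_carrier_mat[OF M] u] by simp
    show ?case unfolding eq using Suc step[of "M ^\<^sub>m k *\<^sub>v u"] M by auto
  qed
  define r where "r k = c * \<rho> ^ k * (\<Sum>j<n. norm (u $ j))" for k
  define K where "K = (\<Sum>a<n. \<Sum>b<n. norm (B a b))"
  \<comment> \<open>\<open>Q\<close> does not increase under \<open>M\<close>, so - Q(u) is at most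
    - Q at the k-th iterate, which is squeezed to 0.\<close>
  have "- Q u \<le> K * (r k)\<^sup>2" for k
  proof -
    have "norm ((M ^\<^sub>m k *\<^sub>v u) $ a) \<le> r k" if a: "a < n" for a
    proof -
      have "(M ^\<^sub>m k *\<^sub>v u) $ a = (\<Sum>j<n. (M ^\<^sub>m k) $$ (a, j) * u $ j)"
        using a u M pow_carrier_mat[OF M, of k]
        by (simp add: scalar_prod_def lessThan_atLeast0)
      also have "norm \<dots> \<le> (\<Sum>j<n. c * \<rho> ^ k * norm (u $ j))"
      proof (intro sum_norm_le)
        fix j assume j: "j \<in> {..<n}"
        have "norm ((M ^\<^sub>m k) $$ (a, j)) \<le> c * \<rho> ^ k"
          using c(4)[of k] a j M pow_carrier_mat[OF M, of k] by (auto simp: norm_bound_def)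
        then show "norm ((M ^\<^sub>m k) $$ (a, j) * u $ j) \<le> c * \<rho> ^ k * norm (u $ j)"
          by (simp add: norm_mult mult_right_mono)
      qed
      finally show ?thesis by (simp add: r_def sum_distrib_left)
    qed
    then have "norm (gram_form n B (M ^\<^sub>m k *\<^sub>v u) (M ^\<^sub>m k *\<^sub>v u)) \<le> K * (r k)\<^sup>2"
      unfolding K_def using c by (intro norm_gram_form_le) (auto simp: r_def sum_nonneg)
    then have "- Q (M ^\<^sub>m k *\<^sub>v u) \<le> K * (r k)\<^sup>2"
      using abs_Re_le_cmod[of "gram_form n B (M ^\<^sub>m k *\<^sub>v u) (M ^\<^sub>m k *\<^sub>v u)"] by (simp add: Q_def)
    then show ?thesis using pow[of k] by linarith
  qed
  moreover have "(\<lambda>k. K * (r k)\<^sup>2) \<longlonglongrightarrow> K * (c * 0 * (\<Sum>j<n. norm (u $ j)))\<^sup>2"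
    unfolding r_def using c by (intro tendsto_intros LIMSEQ_realpow_zero) auto
  ultimately have "- Q u \<le> 0"
    by (intro LIMSEQ_le_const[of "\<lambda>k. K * (r k)\<^sup>2"]) auto
  then show ?thesis by (simp add: Q_def)
qed

section \<open>Division by the column module\<close>

abbreviation unit_poly :: "nat \<Rightarrow> complex poly \<Rightarrow> nat \<Rightarrow> complex poly" where
  "unit_poly i f \<equiv> (\<lambda>j. if j = i then f else 0)"

lemma sum_mult_unit:
  fixes f :: "nat \<Rightarrow> 'a::comm_semiring_0"
  assumes "k < p"
  shows "(\<Sum>j<p. f j * (if j = k then c else 0)) = f k * c"
proof -
  have "(\<Sum>j<p. f j * (if j = k then c else 0)) = (\<Sum>j<p. if j = k then f j * c else 0)"
    by (intro sum.cong) auto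
  then show ?thesis using assms by simp
qed

text \<open>Used for three matrices: F, its dominant part, and the D of the overview. Triangularity
  concerns only the coefficients of degree \<open>N k\<close>; entries below the diagonal may be
  nonzero in lower degree.\<close>

locale column_module =
  fixes p :: nat and N :: "nat \<Rightarrow> nat" and D :: "nat \<Rightarrow> nat \<Rightarrow> complex poly"
  assumes degree_D: "i < p \<Longrightarrow> k < p \<Longrightarrow> degree (D i k) \<le> N k"
    and lower_D: "i < p \<Longrightarrow> k < i \<Longrightarrow> coeff (D i k) (N k) = 0"
    and diag_D: "k < p \<Longrightarrow> coeff (D k k) (N k) \<noteq> 0"
begin

definition comb :: "(nat \<Rightarrow> complex poly) \<Rightarrow> nat \<Rightarrow> complex poly" where
  "comb q j = (\<Sum>k<p. D j k * q k)"

text \<open>Stated through coefficients rather than \<open>degree\<close>, so that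
  \<open>N j = 0\<close> forces \<open>u j = 0\<close>.\<close>

definition small :: "(nat \<Rightarrow> complex poly) \<Rightarrow> bool" where
  "small u \<longleftrightarrow> (\<forall>j<p. \<forall>n\<ge>N j. coeff (u j) n = 0)"

definition reducible :: "(nat \<Rightarrow> complex poly) \<Rightarrow> bool" where
  "reducible u \<longleftrightarrow> (\<exists>q r. small r \<and> (\<forall>j<p. u j = r j + comb q j))"

lemma comb_add: "comb (\<lambda>k. q k + q' k) j = comb q j + comb q' j"
  by (simp add: comb_def algebra_simps sum.distrib)

lemma comb_mult: "comb (\<lambda>k. f * q k) j = f * comb q j"
  by (simp add: comb_def sum_distrib_left mult_ac)

lemma comb_smult: "comb (\<lambda>k. smult c (q k)) j = smult c (comb q j)"
  using comb_mult[of "[:c:]"] by simp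

lemma comb_sum: "comb (\<lambda>k. \<Sum>a\<in>A. q a k) j = (\<Sum>a\<in>A. comb (q a) j)"
  unfolding comb_def sum_distrib_left by (rule sum.swap)

lemma comb_0 [simp]: "comb (\<lambda>k. 0) j = 0"
  by (simp add: comb_def)

lemma comb_unit: "k < p \<Longrightarrow> comb (unit_poly k f) j = D j k * f"
  unfolding comb_def by (rule sum_mult_unit)

lemma small_add: "small r \<Longrightarrow> small r' \<Longrightarrow> small (\<lambda>j. r j + r' j)"
  by (simp add: small_def)

lemma small_smult: "small r \<Longrightarrow> small (\<lambda>j. smult c (r j))"
  by (simp add: small_def)

lemma small_sum: "(\<And>a. a \<in> A \<Longrightarrow> small (r a)) \<Longrightarrow> small (\<lambda>j. \<Sum>a\<in>A. r a j)"
  by (simp add: small_def coeff_sum)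

lemma reducible_cong: "reducible u \<Longrightarrow> (\<And>j. j < p \<Longrightarrow> v j = u j) \<Longrightarrow> reducible v"
  by (auto simp: reducible_def)

lemma reducible_small: "small u \<Longrightarrow> reducible u"
  unfolding reducible_def by (intro exI[of _ "\<lambda>k. 0"] exI[of _ u]) simp

lemma reducible_comb: "reducible (comb q)"
  unfolding reducible_def by (intro exI[of _ q] exI[of _ "\<lambda>k. 0"]) (simp add: small_def)

lemma reducible_add: "reducible u \<Longrightarrow> reducible v \<Longrightarrow> reducible (\<lambda>j. u j + v j)"
proof -
  assume "reducible u" "reducible v"
  then obtain q r q' r' where "small r" "\<forall>j<p. u j = r j + comb q j"
    "small r'" "\<forall>j<p. v j = r' j + comb q' j"
    by (auto simp: reducible_def)
  then show ?thesis
    unfolding reducible_def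
    by (intro exI[of _ "\<lambda>k. q k + q' k"] exI[of _ "\<lambda>k. r k + r' k"])
       (auto simp: comb_add small_add)
qed

lemma reducible_smult: "reducible u \<Longrightarrow> reducible (\<lambda>j. smult c (u j))"
proof -
  assume "reducible u"
  then obtain q r where "small r" "\<forall>j<p. u j = r j + comb q j"
    by (auto simp: reducible_def)
  then show ?thesis
    unfolding reducible_def
    by (intro exI[of _ "\<lambda>k. smult c (q k)"] exI[of _ "\<lambda>k. smult c (r k)"])
       (auto simp: comb_smult small_smult smult_add_right)
qed

lemma reducible_sum:
  "finite A \<Longrightarrow> (\<And>a. a \<in> A \<Longrightarrow> reducible (u a)) \<Longrightarrow> reducible (\<lambda>j. \<Sum>a\<in>A. u a j)"
proof (induction A rule: finite_induct)
  case empty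
  then show ?case by (simp add: reducible_small small_def)
next
  case (insert a A)
  then have "reducible (\<lambda>j. u a j + (\<Sum>a\<in>A. u a j))"
    by (intro reducible_add) auto
  then show ?case using insert by simp
qed

text \<open>Only monomials that occur in \<open>u\<close> have to be reducible; in the induction
  that follows, these are the smaller ones.\<close>

lemma reducible_if_monoms:
  assumes "\<And>j n. j < p \<Longrightarrow> coeff (u j) n \<noteq> 0 \<Longrightarrow> reducible (unit_poly j (monom 1 n))"
  shows "reducible u"
proof -
  have *: "reducible (\<lambda>l. smult (coeff (u j) n) (unit_poly j (monom 1 n) l))" if "j < p" for j n
  proof (cases "coeff (u j) n = 0")
    case True
    then show ?thesis by (simp add: reducible_small small_def)
  next
    case False
    then show ?thesis using assms[of j n] that by (intro reducible_smult) auto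
  qed
  have "reducible (\<lambda>l. \<Sum>j<p. \<Sum>n\<le>degree (u j). smult (coeff (u j) n) (unit_poly j (monom 1 n) l))"
    by (intro reducible_sum *) auto
  then show ?thesis
  proof (rule reducible_cong)
    fix l assume l: "l < p"
    have "(\<Sum>j<p. \<Sum>n\<le>degree (u j). smult (coeff (u j) n) (unit_poly j (monom 1 n) l))
      = (\<Sum>j<p. if j = l then \<Sum>n\<le>degree (u j). monom (coeff (u j) n) n else 0)"
      by (intro sum.cong) (auto simp: smult_monom)
    also have "\<dots> = u l" using l by (simp add: poly_as_sum_of_monoms)
    finally show "u l = (\<Sum>j<p. \<Sum>n\<le>degree (u j). smult (coeff (u j) n) (unit_poly j (monom 1 n) l))"
      by simp
  qed
qed

text \<open>The columns of \<open>D\<close> form a Groebner basis: by triangularity the leading term of column \<open>k\<close> is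
  the \<open>N k\<close>-th power of the indeterminate in row \<open>k\<close>, if monomials are ordered by degree and then by
  row.\<close>

lemma reducible_monom: "i < p \<Longrightarrow> reducible (unit_poly i (monom 1 d))"
proof (induction d arbitrary: i rule: less_induct)
  case (less d)
  note smaller_degree = less.IH
  show ?case using less.prems
  proof (induction i rule: less_induct)
    case (less i)
    show ?case
    proof (cases "d < N i")
      case True
      then show ?thesis by (intro reducible_small) (auto simp: small_def)
    next
      case False
      define h where "h = coeff (D i i) (N i)"
      have h: "h \<noteq> 0" using diag_D less.prems by (simp add: h_def)
      define q where "q = unit_poly i (monom 1 (d - N i))"
      have q: "comb q j = monom 1 (d - N i) * D j i" for j
        using comb_unit[OF less.prems] by (simp add: q_def mult.commute)
      \<comment> \<open>Subtracting a shifted column cancels the monomial itself. What remains has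
        smaller degree, or the same degree in an earlier row; hence the nested inductions on degree
        and row.\<close>
      define e where "e j = unit_poly i (monom h d) j - comb q j" for j
      have "reducible e"
      proof (rule reducible_if_monoms)
        fix j n assume j: "j < p" and n: "coeff (e j) n \<noteq> 0"
        have "n < d \<or> (n = d \<and> j < i)"
        proof (rule ccontr)
          assume *: "\<not> (n < d \<or> n = d \<and> j < i)"
          then have nd: "n \<ge> d" by simp
          have eq: "coeff (e j) n = (if j = i \<and> n = d then h else 0) - coeff (D j i) (n - (d - N i))"
            using nd by (auto simp: e_def q coeff_monom_mult)
          show False
          proof (cases "n = d")
            case True
            then have "j = i \<or> i < j" using * by auto
            then show False
              using n[unfolded eq] False True lower_D[OF j, of i] by (auto simp: h_def)
          next
            case d: False
            then have "n - (d - N i) > N i" using nd False by auto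
            then have "coeff (D j i) (n - (d - N i)) = 0"
              using degree_D[OF j less.prems] by (intro coeff_eq_0) simp
            then show False using n d by (simp add: eq)
          qed
        qed
        then show "reducible (unit_poly j (monom 1 n))"
          using smaller_degree less.IH j by auto
      qed
      then have "reducible (\<lambda>j. smult (1 / h) (e j + comb q j))"
        by (intro reducible_smult reducible_add reducible_comb)
      then show ?thesis
        by (rule reducible_cong) (auto simp: e_def smult_monom h)
    qed
  qed
qed

lemma division: "\<exists>q r. small r \<and> (\<forall>j<p. u j = r j + comb q j)"
  using reducible_if_monoms[of u] reducible_monom by (simp add: reducible_def)

text \<open>Top terms cannot cancel. Among the k with \<open>q k\<close> nonzero that maximize
  \<open>N k + degree (q k)\<close>, let i be the largest. In row i the earlier columns have no term
  of degree \<open>N k\<close>, so the coefficient at the maximal degree comes from column i alone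
  and is nonzero. That degree is at least \<open>N i\<close>, against smallness.\<close>

lemma small_comb_imp_zero:
  assumes "small (comb q)" and "k < p"
  shows "q k = 0"
proof (rule ccontr)
  assume "q k \<noteq> 0"
  define K where "K = {k. k < p \<and> q k \<noteq> 0}"
  have K: "finite K" "K \<noteq> {}" using \<open>q k \<noteq> 0\<close> \<open>k < p\<close> by (auto simp: K_def)
  define M where "M = Max ((\<lambda>k. N k + degree (q k)) ` K)"
  define K' where "K' = {k \<in> K. N k + degree (q k) = M}"
  have M: "N k + degree (q k) \<le> M" if "k \<in> K" for k
    using K that by (auto simp: M_def)
  have "M \<in> (\<lambda>k. N k + degree (q k)) ` K"
    unfolding M_def using K by (intro Max_in) auto
  then have K': "finite K'" "K' \<noteq> {}" using K by (auto simp: K'_def)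
  define i where "i = Max K'"
  have i: "i \<in> K'" and i_max: "\<And>k. k \<in> K' \<Longrightarrow> k \<le> i"
    using K' by (auto simp: i_def)
  then have ip: "i < p" "q i \<noteq> 0" "N i + degree (q i) = M" by (auto simp: K'_def K_def)
  have terms: "coeff (D i k * q k) M = (if k = i then coeff (D i i) (N i) * lead_coeff (q i) else 0)"
    if k: "k < p" for k
  proof (cases "q k = 0")
    case True
    then show ?thesis using ip by auto
  next
    case False
    then have kK: "k \<in> K" using k by (simp add: K_def)
    have deg: "degree (D i k) \<le> N k" by (rule degree_D[OF ip(1) k])
    have top: "coeff (D i k * q k) (N k + degree (q k)) = coeff (D i k) (N k) * lead_coeff (q k)"
    proof (cases "degree (D i k) = N k")
      case True
      then show ?thesis using coeff_mult_degree_sum[of "D i k" "q k"] by simp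
    next
      case neq: False
      then have "degree (D i k * q k) < N k + degree (q k)"
        using deg degree_mult_le[of "D i k" "q k"] by linarith
      then show ?thesis using neq deg by (simp add: coeff_eq_0)
    qed
    show ?thesis
    proof (cases "k \<in> K'")
      case True
      then have eq: "N k + degree (q k) = M" by (simp add: K'_def)
      show ?thesis
      proof (cases "k = i")
        case True then show ?thesis using top eq by simp
      next
        case False
        then have "coeff (D i k) (N k) = 0"
          using i_max[OF True] lower_D[OF ip(1), of k] by simp
        then show ?thesis using top eq False by simp
      qed
    next
      case False
      then have "N k + degree (q k) < M" using kK M[OF kK] by (auto simp: K'_def)
      then have "degree (D i k * q k) < M"
        using deg degree_mult_le[of "D i k" "q k"] by linarith
      then show ?thesis using False i by (auto simp: coeff_eq_0)
    qed
  qed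
  have "coeff (comb q i) M = (\<Sum>k<p. if k = i then coeff (D i i) (N i) * lead_coeff (q i) else 0)"
    unfolding comb_def coeff_sum by (intro sum.cong) (auto simp: terms)
  also have "\<dots> = coeff (D i i) (N i) * lead_coeff (q i)" using ip by simp
  also have "\<dots> \<noteq> 0" using diag_D ip by simp
  finally show False using assms(1) ip by (auto simp: small_def)
qed

lemma det_nonzero: "Determinant.det (mat p p (\<lambda>(i, k). D i k)) \<noteq> 0"
proof
  let ?A = "mat p p (\<lambda>(i, k). D i k)"
  assume "Determinant.det ?A = 0"
  then obtain v where v: "v \<in> carrier_vec p" "v \<noteq> 0\<^sub>v p" "?A *\<^sub>v v = 0\<^sub>v p"
    using det_0_iff_vec_prod_zero[of ?A p] by auto
  have "comb (\<lambda>k. v $ k) j = 0" if "j < p" for j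
  proof -
    have "comb (\<lambda>k. v $ k) j = (?A *\<^sub>v v) $ j"
      using that v(1) by (auto simp: comb_def scalar_prod_def lessThan_atLeast0 intro!: sum.cong)
    then show ?thesis using v(3) that by simp
  qed
  then have "small (comb (\<lambda>k. v $ k))" by (simp add: small_def)
  then have "v = 0\<^sub>v p"
    using small_comb_imp_zero v(1) by (intro eq_vecI) auto
  then show False using v(2) by simp
qed

text \<open>Cramer's rule with \<psi> = det D: the quotient by the column module is torsion, so each
  class has an annihilating polynomial whose roots can be examined.\<close>

lemma exists_annihilator: "\<exists>\<psi> q. \<psi> \<noteq> 0 \<and> (\<forall>j<p. \<psi> * u j = comb q j)"
proof -
  define A where "A = mat p p (\<lambda>(i, k). D i k)"
  define \<psi> where "\<psi> = Determinant.det A"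
  have A: "A \<in> carrier_mat p p" by (simp add: A_def)
  note adj = adj_mat[OF A]
  define w where "w = adj_mat A *\<^sub>v vec p u"
  have "A *\<^sub>v w = (A * adj_mat A) *\<^sub>v vec p u"
    unfolding w_def using assoc_mult_mat_vec[OF A adj(1), of "vec p u"] by simp
  also have "\<dots> = \<psi> \<cdot>\<^sub>v vec p u"
    unfolding adj(2) by (auto simp: \<psi>_def intro!: eq_vecI simp: scalar_prod_def sum_mult_unit if_distrib[where f = "\<lambda>x. _ * x"] if_distrib[where f = "\<lambda>x. x * _"] cong: if_cong)
  finally have eq: "A *\<^sub>v w = \<psi> \<cdot>\<^sub>v vec p u" .
  have "\<psi> * u j = comb (\<lambda>k. w $ k) j" if "j < p" for j
  proof -
    have "comb (\<lambda>k. w $ k) j = (A *\<^sub>v w) $ j"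
      using that adj(1) A
      by (auto simp: comb_def scalar_prod_def lessThan_atLeast0 A_def w_def intro!: sum.cong)
    then show ?thesis using that eq by simp
  qed
  then show ?thesis using det_nonzero by (auto simp: \<psi>_def A_def)
qed

end

section \<open>The Hermitian form of a lossless pair\<close>

text \<open>The para-conjugate of control theory: on the imaginary axis its values are the complex
  conjugates of those of f.\<close>

definition para :: "complex poly \<Rightarrow> complex poly" where
  "para f = pcompose (map_poly cnj f) [:0, -1:]"

lemma coeff_para: "coeff (para f) n = (-1) ^ n * cnj (coeff f n)"
  by (simp add: para_def coeff_pcompose_linear coeff_map_poly)

lemma poly_para: "poly (para f) z = cnj (poly f (- cnj z))"
proof -
  have "poly (map_poly cnj f) w = cnj (poly f (cnj w))" for w
    by (induction f) (auto simp: map_poly_pCons)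
  then show ?thesis by (simp add: para_def poly_pcompose)
qed

lemma para_add [simp]: "para (f + g) = para f + para g"
  by (rule poly_ext) (simp add: poly_para)

lemma para_mult [simp]: "para (f * g) = para f * para g"
  by (rule poly_ext) (simp add: poly_para)

lemma para_smult [simp]: "para (smult c f) = smult (cnj c) (para f)"
  by (rule poly_ext) (simp add: poly_para)

lemma para_para [simp]: "para (para f) = f"
  by (rule poly_ext) (simp add: poly_para)

lemma para_0 [simp]: "para 0 = 0"
  by (rule poly_ext) (simp add: poly_para)

lemma para_const [simp]: "para [:c:] = [:cnj c:]"
  by (rule poly_ext) (simp add: poly_para)

lemma para_1 [simp]: "para 1 = 1"
  by (rule poly_ext) (simp add: poly_para)

lemma para_X [simp]: "para [:0, 1:] = - [:0, 1:]"
  by (rule poly_ext) (simp add: poly_para)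

lemma para_sum: "para (\<Sum>a\<in>A. f a) = (\<Sum>a\<in>A. para (f a))"
  by (rule poly_ext) (simp add: poly_para poly_sum)

lemma degree_para [simp]: "degree (para f) = degree f"
  by (intro antisym degree_le) (auto simp: coeff_para coeff_eq_0 le_degree dest: coeff_eq_0)

lemma sum_const_poly: "(\<Sum>a\<in>A. [:f a:]) = [:\<Sum>a\<in>A. f a:]"
  by (induction A rule: infinite_finite_induct) auto

text \<open>\<open>L i j f\<close> models the coefficient of 1/\<lambda> in the product of f with
  entry (i, j) of W, and \<open>L_D\<close> holds because W D is polynomial. \<open>S_eq\<close> is
  the same coefficient of W (D(\<lambda>) - D(\<mu>))/(\<lambda> - \<mu>), where W D = S: the first
  part yields S(\<mu>), and the second is of order \<lambda>^(-2) because W vanishes at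
  infinity.\<close>

locale column_functional = column_module +
  fixes L :: "nat \<Rightarrow> nat \<Rightarrow> complex poly \<Rightarrow> complex" and S :: "nat \<Rightarrow> nat \<Rightarrow> complex poly"
  assumes L_add: "L i j (f + g) = L i j f + L i j g"
    and L_smult: "L i j (smult c f) = c * L i j f"
    and L_D: "i < p \<Longrightarrow> k < p \<Longrightarrow> (\<Sum>j<p. L i j (g * D j k)) = 0"
    and S_eq: "i < p \<Longrightarrow> k < p \<Longrightarrow> poly (S i k) \<mu> = (\<Sum>j<p. L i j (synthetic_div (D j k) \<mu>))"
begin

text \<open>This is P of the overview; \<open>out\<close> is its C.\<close>

definition form :: "(nat \<Rightarrow> complex poly) \<Rightarrow> (nat \<Rightarrow> complex poly) \<Rightarrow> complex" where
  "form u v = (\<Sum>i<p. \<Sum>j<p. L i j (para (u i) * v j))"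

definition out :: "(nat \<Rightarrow> complex poly) \<Rightarrow> nat \<Rightarrow> complex" where
  "out u i = (\<Sum>j<p. L i j (u j))"

lemma L_0 [simp]: "L i j 0 = 0"
  using L_smult[of i j 0 0] by simp

lemma L_sum: "L i j (\<Sum>a\<in>A. f a) = (\<Sum>a\<in>A. L i j (f a))"
  by (induction A rule: infinite_finite_induct) (auto simp: L_add)

lemma form_cong:
  "(\<And>j. j < p \<Longrightarrow> u j = u' j) \<Longrightarrow> (\<And>j. j < p \<Longrightarrow> v j = v' j) \<Longrightarrow> form u v = form u' v'"
  by (simp add: form_def)

lemma form_add_left: "form (\<lambda>j. u j + u' j) v = form u v + form u' v"
  by (simp add: form_def algebra_simps L_add sum.distrib)

lemma form_add_right: "form u (\<lambda>j. v j + v' j) = form u v + form u v'"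
  by (simp add: form_def algebra_simps L_add sum.distrib)

lemma form_smult_left: "form (\<lambda>j. smult c (u j)) v = cnj c * form u v"
  by (simp add: form_def L_smult sum_distrib_left)

lemma form_smult_right: "form u (\<lambda>j. smult c (v j)) = c * form u v"
  by (simp add: form_def L_smult sum_distrib_left)

lemma form_mult: "form (\<lambda>j. f * u j) v = form u (\<lambda>j. para f * v j)"
  by (simp add: form_def mult_ac)

lemma form_0_left: "(\<And>j. j < p \<Longrightarrow> u j = 0) \<Longrightarrow> form u v = 0"
  by (simp add: form_def)

lemma form_sum_left: "form (\<lambda>j. \<Sum>a\<in>A. u a j) v = (\<Sum>a\<in>A. form (u a) v)"
  by (induction A rule: infinite_finite_induct) (auto simp: form_add_left form_0_left)

lemma form_sum_right: "form u (\<lambda>j. \<Sum>a\<in>A. v a j) = (\<Sum>a\<in>A. form u (v a))"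
  by (induction A rule: infinite_finite_induct) (auto simp: form_add_right form_def L_add algebra_simps sum.distrib)

lemma L_comb: "i < p \<Longrightarrow> (\<Sum>j<p. L i j (g * comb q j)) = 0"
proof -
  assume i: "i < p"
  have "(\<Sum>j<p. L i j (g * comb q j)) = (\<Sum>k<p. \<Sum>j<p. L i j ((g * q k) * D j k))"
    unfolding comb_def sum_distrib_left L_sum by (subst sum.swap) (simp add: mult_ac)
  then show ?thesis using L_D[OF i] by simp
qed

lemma form_comb_right: "form u (comb q) = 0"
  unfolding form_def by (simp add: L_comb)

lemma out_comb: "i < p \<Longrightarrow> out (comb q) i = 0"
  using L_comb[of i 1 q] by (simp add: out_def)

lemma form_const_left: "form (\<lambda>j. [:c j:]) v = (\<Sum>i<p. cnj (c i) * out v i)"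
  by (simp add: form_def out_def L_smult sum_distrib_left)

lemma form_unit_left: "i < p \<Longrightarrow> form (unit_poly i 1) v = out v i"
proof -
  assume i: "i < p"
  have "form (unit_poly i 1) v = (\<Sum>l<p. if l = i then out v l else 0)"
    unfolding form_def out_def by (intro sum.cong) auto
  then show ?thesis using i by simp
qed

lemma form_units:
  assumes "i < p" "j < p"
  shows "form (unit_poly i f) (unit_poly j g) = L i j (para f * g)"
proof -
  have "form (unit_poly i f) (unit_poly j g)
      = (\<Sum>l<p. \<Sum>m<p. if m = j then (if l = i then L i j (para f * g) else 0) else 0)"
    unfolding form_def by (intro sum.cong) auto
  then show ?thesis using assms by simp
qed

definition hermitian_functional :: bool where
  "hermitian_functional \<longleftrightarrow> (\<forall>i<p. \<forall>j<p. \<forall>f. L i j (para f) = cnj (L j i f))"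

lemma form_swap_if:
  assumes "\<And>i j. i < p \<Longrightarrow> j < p \<Longrightarrow> L i j (para (para (v j) * u i)) = cnj (L j i (para (v j) * u i))"
  shows "form u v = cnj (form v u)"
proof -
  have "cnj (form v u) = (\<Sum>j<p. \<Sum>i<p. cnj (L j i (para (v j) * u i)))"
    by (simp add: form_def)
  also have "\<dots> = (\<Sum>i<p. \<Sum>j<p. cnj (L j i (para (v j) * u i)))"
    by (rule sum.swap)
  also have "\<dots> = (\<Sum>i<p. \<Sum>j<p. L i j (para (u i) * v j))"
    using assms by (intro sum.cong) (auto simp: mult_ac)
  finally show ?thesis by (simp add: form_def)
qed

text \<open>Symmetry on low degrees gives \<open>form (D e\<^sub>a) r = 0\<close> for all remainders \<open>r\<close>; shifting powers of the
  indeterminate to the other side then shows that the column module is in the left kernel, too.\<close>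

lemma hermitian_functional_if_low_degree:
  assumes low: "\<And>i j f. i < p \<Longrightarrow> j < p \<Longrightarrow> degree f \<le> 2 * l + 1 \<Longrightarrow> L i j (para f) = cnj (L j i f)"
    and N: "\<And>k. k < p \<Longrightarrow> N k \<le> l + 1"
  shows hermitian_functional
proof -
  \<comment> \<open>The bound \<open>2 * l + 1\<close> is the largest degree met below, by a column
    of degree at most \<open>l + 1\<close> against a remainder of degree at most
    \<open>l\<close>.\<close>
  have low_form: "form u v = cnj (form v u)"
    if "\<And>i j. i < p \<Longrightarrow> j < p \<Longrightarrow> degree (u i) + degree (v j) \<le> 2 * l + 1" for u v
  proof (rule form_swap_if)
    fix i j assume ij: "i < p" "j < p"
    have "degree (para (v j) * u i) \<le> 2 * l + 1"
      using degree_mult_le[of "para (v j)" "u i"] that[OF ij] by simp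
    then show "L i j (para (para (v j) * u i)) = cnj (L j i (para (v j) * u i))"
      by (intro low ij)
  qed
  have small_degree: "degree (r j) \<le> l" if "small r" "j < p" for r j
    using that N[OF that(2)] by (intro degree_le) (auto simp: small_def)
  have col: "form (\<lambda>i. D i a) v = 0" if a: "a < p" for a v
  proof -
    obtain q r where r: "small r" "\<And>j. j < p \<Longrightarrow> v j = r j + comb q j"
      using division[of v] by blast
    have "form (\<lambda>i. D i a) v = form (\<lambda>i. D i a) (\<lambda>j. r j + comb q j)"
      using r by (intro form_cong) auto
    also have "\<dots> = form (\<lambda>i. D i a) r"
      using form_comb_right[of _ q] by (simp add: form_add_right)
    also have "\<dots> = cnj (form r (\<lambda>i. D i a))"
    proof (rule low_form)
      fix i j assume "i < p" "j < p"
      then show "degree (D i a) + degree (r j) \<le> 2 * l + 1"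
        using small_degree[OF r(1), of j] degree_D[of i a] N[OF a] a by linarith
    qed
    also have "form r (\<lambda>i. D i a) = form r (comb (unit_poly a 1))"
      using comb_unit[OF a, of 1] by (intro form_cong) simp_all
    finally show ?thesis by (simp only: form_comb_right complex_cnj_zero)
  qed
  have comb: "form (comb q) v = 0" for q v
  proof -
    have "form (comb q) v = form (\<lambda>i. \<Sum>k<p. q k * D i k) v"
      by (intro form_cong) (simp_all add: comb_def mult_ac)
    also have "\<dots> = (\<Sum>k<p. form (\<lambda>i. q k * D i k) v)"
      by (rule form_sum_left)
    finally show ?thesis by (simp add: form_mult col)
  qed
  have sym: "form u v = cnj (form v u)" for u v
  proof -
    obtain q r where r: "small r" "\<And>j. j < p \<Longrightarrow> u j = r j + comb q j"
      using division[of u] by blast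
    obtain q' r' where r': "small r'" "\<And>j. j < p \<Longrightarrow> v j = r' j + comb q' j"
      using division[of v] by blast
    have uv: "form u v = form (\<lambda>j. r j + comb q j) (\<lambda>j. r' j + comb q' j)"
      and vu: "form v u = form (\<lambda>j. r' j + comb q' j) (\<lambda>j. r j + comb q j)"
      using r r' by (auto intro!: form_cong)
    have "form r r' = cnj (form r' r)"
    proof (rule low_form)
      fix i j assume "i < p" "j < p"
      then show "degree (r i) + degree (r' j) \<le> 2 * l + 1"
        using small_degree[OF r(1), of i] small_degree[OF r'(1), of j] by linarith
    qed
    then show ?thesis
      unfolding uv vu form_add_left form_add_right comb form_comb_right by simp
  qed
  show ?thesis
    unfolding hermitian_functional_def
  proof (intro allI impI)
    fix i j f assume ij: "i < p" "j < p"
    show "L i j (para f) = cnj (L j i f)"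
      using sym[of "unit_poly i f" "unit_poly j 1"] ij by (simp add: form_units)
  qed
qed

lemma form_swap: "hermitian_functional \<Longrightarrow> form u v = cnj (form v u)"
  unfolding hermitian_functional_def by (rule form_swap_if) blast

lemma form_comb_left: "hermitian_functional \<Longrightarrow> form (comb q) v = 0"
  by (subst form_swap) (auto simp: form_comb_right)

lemma form_X_skew: "hermitian_functional \<Longrightarrow> Re (form v (\<lambda>j. [:0, 1:] * v j)) = 0"
proof -
  assume h: hermitian_functional
  have "form v (\<lambda>j. [:0, 1:] * v j) = cnj (form (\<lambda>j. [:0, 1:] * v j) v)"
    by (rule form_swap[OF h])
  also have "form (\<lambda>j. [:0, 1:] * v j) v = form v (\<lambda>j. smult (-1) ([:0, 1:] * v j))"
    unfolding form_mult by (intro form_cong) auto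
  also have "\<dots> = - form v (\<lambda>j. [:0, 1:] * v j)"
    by (subst form_smult_right) simp
  finally show ?thesis by (simp add: complex_eq_iff)
qed

text \<open>By symmetry the constant vector moves to the left slot, where the form merely reads off
  \<open>out\<close>. This is the dissipation term of the energy balance.\<close>

lemma form_const_right:
  "hermitian_functional \<Longrightarrow> form v (\<lambda>j. [:out v j:]) = of_real (\<Sum>i<p. (norm (out v i))\<^sup>2)"
proof -
  assume h: hermitian_functional
  have "form v (\<lambda>j. [:out v j:]) = cnj (form (\<lambda>j. [:out v j:]) v)"
    by (rule form_swap[OF h])
  also have "\<dots> = (\<Sum>i<p. out v i * cnj (out v i))"
    by (simp add: form_const_left)
  finally show ?thesis by (simp only: complex_norm_square of_real_sum)
qed

section \<open>Eigenvectors of the closed loop\<close>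

definition closed_loop :: "complex \<Rightarrow> (nat \<Rightarrow> complex) \<Rightarrow> bool" where
  "closed_loop \<mu> x \<longleftrightarrow> (\<forall>i<p. (\<Sum>k<p. (poly (D i k) \<mu> + poly (S i k) \<mu>) * x k) = 0)"

text \<open>Eigenvectors of the closed loop operator \<open>u \<mapsto> \<lambda> u - out u\<close> modulo the column module
  correspond to kernel vectors of \<open>D + S\<close>: this lemma and the next are the two directions.\<close>

lemma kernel_to_eigenvector:
  assumes x: "closed_loop \<mu> x"
  defines "u \<equiv> \<lambda>j. \<Sum>k<p. smult (x k) (synthetic_div (D j k) \<mu>)"
  shows "j < p \<Longrightarrow> [:0, 1:] * u j = smult \<mu> (u j) + comb (\<lambda>k. [:x k:]) j + [:out u j:]"
    and "i < p \<Longrightarrow> out u i = (\<Sum>k<p. poly (S i k) \<mu> * x k)"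
proof -
  show out: "out u i = (\<Sum>k<p. poly (S i k) \<mu> * x k)" if i: "i < p" for i
  proof -
    have "out u i = (\<Sum>j<p. \<Sum>k<p. x k * L i j (synthetic_div (D j k) \<mu>))"
      by (simp add: out_def u_def L_sum L_smult)
    also have "\<dots> = (\<Sum>k<p. \<Sum>j<p. x k * L i j (synthetic_div (D j k) \<mu>))"
      by (rule sum.swap)
    finally show ?thesis using i by (simp add: S_eq sum_distrib_left mult_ac)
  qed
  \<comment> \<open>Since u = (D(\<lambda>) - D(\<mu>)) x/(\<lambda> - \<mu>), one has (\<lambda> -
    \<mu>) u = D x - D(\<mu>) x, and the closed loop equation replaces - D(\<mu>) x by S(\<mu>) x,
    which is \<open>out u\<close>.\<close>
  show "[:0, 1:] * u j = smult \<mu> (u j) + comb (\<lambda>k. [:x k:]) j + [:out u j:]" if j: "j < p"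
  proof -
    have synth: "[:0, 1:] * synthetic_div (D j k) \<mu>
        = smult \<mu> (synthetic_div (D j k) \<mu>) + D j k - [:poly (D j k) \<mu>:]" for k
      using synthetic_div_correct'[of \<mu> "D j k"] by (simp add: algebra_simps)
    have "[:0, 1:] * u j = (\<Sum>k<p. smult (x k) ([:0, 1:] * synthetic_div (D j k) \<mu>))"
      unfolding u_def sum_distrib_left by simp
    also have "\<dots> = smult \<mu> (u j) + comb (\<lambda>k. [:x k:]) j - [:\<Sum>k<p. poly (D j k) \<mu> * x k:]"
      unfolding synth u_def comb_def
      by (simp add: smult_add_right smult_diff_right sum.distrib sum_subtractf smult_sum2 mult_ac
          flip: sum_to_poly)
    also have "(\<Sum>k<p. poly (D j k) \<mu> * x k) = - out u j"
      using x j unfolding out[OF j] closed_loop_def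
      by (simp add: algebra_simps sum.distrib eq_neg_iff_add_eq_0)
    finally show ?thesis by simp
  qed
qed

lemma eigenvector_to_kernel:
  assumes v: "\<And>j. j < p \<Longrightarrow> [:-\<alpha>, 1:] * v j = [:out v j:] + comb q j"
  shows "closed_loop \<alpha> (\<lambda>k. poly (q k) \<alpha>)"
    and "i < p \<Longrightarrow> (\<Sum>k<p. poly (D i k) \<alpha> * poly (q k) \<alpha>) = - out v i"
    and "(\<And>k. k < p \<Longrightarrow> poly (q k) \<alpha> = 0) \<Longrightarrow> \<exists>q'. \<forall>j<p. v j = comb q' j"
proof -
  define q' where "q' k = synthetic_div (q k) \<alpha>" for k
  have q: "q k = [:-\<alpha>, 1:] * q' k + [:poly (q k) \<alpha>:]" for k
    using synthetic_div_correct'[of \<alpha> "q k"] by (simp add: q'_def)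
  show D: "(\<Sum>k<p. poly (D i k) \<alpha> * poly (q k) \<alpha>) = - out v i" if i: "i < p" for i
  proof -
    have "poly ([:-\<alpha>, 1:] * v i) \<alpha> = poly ([:out v i:] + comb q i) \<alpha>"
      by (simp only: v[OF i])
    then show ?thesis
      by (simp add: comb_def poly_sum eq_neg_iff_add_eq_0 add.commute)
  qed
  \<comment> \<open>With q = (\<lambda> - \<alpha>) q' + q(\<alpha>), the whole equation becomes
    divisible by \<lambda> - \<alpha> and gives v = D q' + (D(\<lambda>) - D(\<alpha>))
    q(\<alpha>)/(\<lambda> - \<alpha>).\<close>
  have vj: "v j = comb q' j + (\<Sum>k<p. smult (poly (q k) \<alpha>) (synthetic_div (D j k) \<alpha>))" if j: "j < p" for j
  proof -
    have "[:-\<alpha>, 1:] * v j = [:out v j:] + (\<Sum>k<p. D j k * ([:-\<alpha>, 1:] * q' k + [:poly (q k) \<alpha>:]))"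
      unfolding v[OF j] comb_def by (simp only: q[symmetric])
    also have "\<dots> = [:out v j:] + (\<Sum>k<p. [:-\<alpha>, 1:] * (D j k * q' k) + smult (poly (q k) \<alpha>) (D j k))"
      by (simp add: algebra_simps)
    also have "\<dots> = [:out v j:] + (\<Sum>k<p. [:-\<alpha>, 1:] * (D j k * q' k)
        + smult (poly (q k) \<alpha>) ([:-\<alpha>, 1:] * synthetic_div (D j k) \<alpha> + [:poly (D j k) \<alpha>:]))"
      by (simp only: synthetic_div_correct')
    also have "\<dots> = [:out v j + (\<Sum>k<p. poly (D j k) \<alpha> * poly (q k) \<alpha>):]
        + [:-\<alpha>, 1:] * (comb q' j + (\<Sum>k<p. smult (poly (q k) \<alpha>) (synthetic_div (D j k) \<alpha>)))"
      unfolding comb_def distrib_left[of "[:-\<alpha>, 1:]"] sum_distrib_left sum.distrib smult_add_right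
        mult_smult_right
      by (simp add: sum.distrib sum_const_poly mult_ac add_ac)
    also have "\<dots> = [:-\<alpha>, 1:] * (comb q' j + (\<Sum>k<p. smult (poly (q k) \<alpha>) (synthetic_div (D j k) \<alpha>)))"
      using D[OF j] by simp
    finally have "[:-\<alpha>, 1:] * v j
        = [:-\<alpha>, 1:] * (comb q' j + (\<Sum>k<p. smult (poly (q k) \<alpha>) (synthetic_div (D j k) \<alpha>)))" .
    moreover have "[:-\<alpha>, 1:] \<noteq> 0" by simp
    ultimately show ?thesis using mult_left_cancel by blast
  qed
  \<comment> \<open>Under \<open>out\<close> the term D q' disappears and \<open>S_eq\<close>
    evaluates the other one, so S(\<alpha>) q(\<alpha>) cancels D(\<alpha>) q(\<alpha>).\<close>
  have S: "(\<Sum>k<p. poly (S i k) \<alpha> * poly (q k) \<alpha>) = out v i" if i: "i < p" for i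
  proof -
    have "out v i = (\<Sum>j<p. L i j (1 * comb q' j)) + (\<Sum>j<p. \<Sum>k<p. poly (q k) \<alpha> * L i j (synthetic_div (D j k) \<alpha>))"
      unfolding out_def by (simp add: vj L_add sum.distrib L_sum L_smult)
    also have "\<dots> = (\<Sum>j<p. \<Sum>k<p. poly (q k) \<alpha> * L i j (synthetic_div (D j k) \<alpha>))"
      by (simp only: L_comb[OF i] add_0)
    also have "\<dots> = (\<Sum>k<p. \<Sum>j<p. poly (q k) \<alpha> * L i j (synthetic_div (D j k) \<alpha>))"
      by (rule sum.swap)
    finally show ?thesis using i by (simp add: S_eq sum_distrib_left mult_ac)
  qed
  show "closed_loop \<alpha> (\<lambda>k. poly (q k) \<alpha>)"
    unfolding closed_loop_def by (simp add: distrib_right sum.distrib D S)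
  show "\<exists>q'. \<forall>j<p. v j = comb q' j" if "\<And>k. k < p \<Longrightarrow> poly (q k) \<alpha> = 0"
    using that by (intro exI[of _ q']) (simp add: vj)
qed

text \<open>Pairing the eigenvector equation with u removes the skew term and leaves Re \<mu> times
  P(u, u) equal to -|out u|^2. If Re \<mu> were nonnegative, then \<open>out u\<close> would vanish,
  and with it P(u, u).\<close>

lemma stable_if_form_positive:
  assumes h: hermitian_functional
    and pos: "\<And>u j. small u \<Longrightarrow> j < p \<Longrightarrow> u j \<noteq> 0 \<Longrightarrow> 0 < Re (form u u)"
    and x: "closed_loop \<mu> x" "k0 < p" "x k0 \<noteq> 0"
  shows "Re \<mu> < 0"
proof -
  define u where "u j = (\<Sum>k<p. smult (x k) (synthetic_div (D j k) \<mu>))" for j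
  note u = kernel_to_eigenvector[OF x(1), folded u_def]
  \<comment> \<open>Positivity is assumed for remainders only, but reduction modulo the columns does
    not change the form.\<close>
  have pos': "(\<exists>q'. \<forall>j<p. u j = comb q' j) \<or> 0 < Re (form u u)"
  proof -
    obtain q r where r: "small r" "\<And>j. j < p \<Longrightarrow> u j = r j + comb q j"
      using division[of u] by blast
    have "form u u = form (\<lambda>j. r j + comb q j) (\<lambda>j. r j + comb q j)"
      using r by (intro form_cong) auto
    also have "\<dots> = form r r"
      unfolding form_add_left form_add_right form_comb_left[OF h] form_comb_right by simp
    finally have eq: "form u u = form r r" .
    show ?thesis
    proof (cases "\<exists>j<p. r j \<noteq> 0")
      case True
      then show ?thesis using pos[OF r(1)] by (auto simp: eq)
    next
      case False
      then show ?thesis using r(2) by auto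
    qed
  qed
  have energy: "Re \<mu> * Re (form u u) = - (\<Sum>i<p. (norm (out u i))\<^sup>2)"
  proof -
    have "form u (\<lambda>j. [:0, 1:] * u j) = form u (\<lambda>j. smult \<mu> (u j) + comb (\<lambda>k. [:x k:]) j + [:out u j:])"
      using u(1) by (intro form_cong) auto
    also have "\<dots> = \<mu> * form u u + of_real (\<Sum>i<p. (norm (out u i))\<^sup>2)"
      unfolding form_add_right form_comb_right form_smult_right form_const_right[OF h] by simp
    finally have "Re (\<mu> * form u u) + (\<Sum>i<p. (norm (out u i))\<^sup>2) = 0"
      using form_X_skew[OF h, of u] by simp
    moreover have "Im (form u u) = 0"
      using form_swap[OF h, of u u] by (simp add: complex_eq_iff)
    ultimately show ?thesis by simp
  qed
  \<comment> \<open>If u = D q', then out u = 0 and D(x - (\<lambda> - \<mu>) q') = 0. Since the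
    columns are independent, x = (\<lambda> - \<mu>) q', and evaluation at \<mu> gives x =
    0.\<close>
  have not_comb: "\<not> (\<exists>q'. \<forall>j<p. u j = comb q' j)"
  proof
    assume "\<exists>q'. \<forall>j<p. u j = comb q' j"
    then obtain q' where q': "\<And>j. j < p \<Longrightarrow> u j = comb q' j" by blast
    have out0: "out u i = 0" if "i < p" for i
      using out_comb[OF that, of q'] q' by (simp add: out_def)
    have "comb (\<lambda>k. [:x k:] + (- [:-\<mu>, 1:]) * q' k) j = 0" if j: "j < p" for j
    proof -
      have "comb (\<lambda>k. [:x k:] + (- [:-\<mu>, 1:]) * q' k) j
          = smult \<mu> (u j) + comb (\<lambda>k. [:x k:]) j - [:0, 1:] * u j"
        unfolding comb_add comb_mult q'[OF j] by simp
      then show ?thesis using u(1)[OF j] out0[OF j] by simp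
    qed
    then have "[:x k0:] + (- [:-\<mu>, 1:]) * q' k0 = 0"
      by (intro small_comb_imp_zero x(2)) (simp add: small_def)
    then have "poly ([:x k0:] + (- [:-\<mu>, 1:]) * q' k0) \<mu> = 0"
      by simp
    then show False using x(3) by simp
  qed
  then have form_pos: "0 < Re (form u u)" using pos' by blast
  show ?thesis
  proof (rule ccontr)
    assume "\<not> Re \<mu> < 0"
    then have "0 \<le> Re \<mu> * Re (form u u)" using form_pos by simp
    then have "(\<Sum>i<p. (norm (out u i))\<^sup>2) \<le> 0" using energy by simp
    moreover have nonneg: "0 \<le> (\<Sum>i<p. (norm (out u i))\<^sup>2)" by (intro sum_nonneg) simp
    ultimately have "(\<Sum>i<p. (norm (out u i))\<^sup>2) = 0" by linarith
    then have out0: "out u i = 0" if "i < p" for i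
      using that by (simp add: sum_nonneg_eq_0_iff)
    \<comment> \<open>From out u = 0 follows (\<lambda> - \<mu>) u = D x, so f u equals f(\<mu>) u
      modulo the columns for every f: u is unobservable.\<close>
    have obs: "(\<Sum>j<p. L i j (f * u j)) = 0" if i: "i < p" for i f
    proof -
      define f' where "f' = synthetic_div f \<mu>"
      have f: "f = [:-\<mu>, 1:] * f' + [:poly f \<mu>:]"
        using synthetic_div_correct'[of \<mu> f] by (simp add: f'_def)
      have fu: "f * u j = f' * comb (\<lambda>k. [:x k:]) j + smult (poly f \<mu>) (u j)" if j: "j < p" for j
      proof -
        have e: "[:-\<mu>, 1:] * u j = comb (\<lambda>k. [:x k:]) j"
          using u(1)[OF j] out0[OF j] by (simp add: algebra_simps)
        have "f * u j = f' * ([:-\<mu>, 1:] * u j) + smult (poly f \<mu>) (u j)"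
          by (subst f) (simp add: algebra_simps)
        then show ?thesis by (simp only: e)
      qed
      have "(\<Sum>j<p. L i j (f * u j)) = (\<Sum>j<p. L i j (f' * comb (\<lambda>k. [:x k:]) j)) + poly f \<mu> * out u i"
        by (simp add: fu L_add L_smult sum.distrib out_def sum_distrib_left)
      then show ?thesis by (simp only: L_comb[OF i] out0[OF i]) simp
    qed
    have "form u u = 0" unfolding form_def by (simp add: obs)
    then show False using form_pos by simp
  qed
qed

text \<open>Cauchy-Schwarz for a semidefinite form: otherwise a small step from u along a suitable
  multiple of v would make the form negative.\<close>

lemma form_kernel_if_isotropic:
  assumes h: hermitian_functional
    and nonneg: "\<And>v. 0 \<le> Re (form v v)"
    and u: "Re (form u u) = 0"
  shows "form u v = 0"
proof (rule ccontr)
  assume nz: "form u v \<noteq> 0"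
  define b where "b = form u v"
  define c where "c = Re (form v v)"
  \<comment> \<open>The value at u + t v is s |b|^2 (s c - 2). The denominator \<open>c + 1\<close>
    ensures s c < 2 and is nonzero even for c = 0.\<close>
  define s where "s = 1 / (c + 1)"
  have c: "c \<ge> 0" using nonneg by (simp add: c_def)
  then have s: "s > 0" "s * c < 2" by (auto simp: s_def field_simps)
  define t where "t = of_real (- s) * cnj b"
  have vu: "form v u = cnj b" using form_swap[OF h, of v u] by (simp add: b_def)
  have "Re (form (\<lambda>j. u j + smult t (v j)) (\<lambda>j. u j + smult t (v j)))
      = Re (form u u + t * b + cnj t * cnj b + cnj t * t * form v v)"
    unfolding form_add_left form_add_right form_smult_left form_smult_right vu b_def[symmetric]
    by (simp add: algebra_simps)
  also have "cnj t * t = of_real (s\<^sup>2 * (norm b)\<^sup>2)"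
    using complex_norm_square[of b] by (simp add: t_def power2_eq_square mult_ac)
  also have "t * b = of_real (- s * (norm b)\<^sup>2)"
    using complex_norm_square[of b] by (simp add: t_def mult_ac)
  also have "cnj t * cnj b = of_real (- s * (norm b)\<^sup>2)"
    using complex_norm_square[of b] by (simp add: t_def mult_ac)
  also have "Re (form u u + of_real (- s * (norm b)\<^sup>2) + of_real (- s * (norm b)\<^sup>2)
      + of_real (s\<^sup>2 * (norm b)\<^sup>2) * form v v) = s * (norm b)\<^sup>2 * (s * c - 2)"
    using u by (simp add: c_def algebra_simps power2_eq_square)
  also have "\<dots> < 0"
    using s nz by (intro mult_pos_neg) (auto simp: b_def)
  finally show False using nonneg[of "\<lambda>j. u j + smult t (v j)"] by simp
qed

text \<open>A nonzero class in the kernel of the form would contain an eigenvector \<open>x\<close> for some \<open>\<alpha>\<close> that is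
  annihilated by \<open>D(\<alpha>)\<close> and by \<open>S(\<alpha>)\<close>. By parity, \<open>-\<alpha>\<close> then is a zero as well.\<close>

lemma form_nondegenerate_if_stable:
  assumes stable: "\<And>\<mu> x k. closed_loop \<mu> x \<Longrightarrow> k < p \<Longrightarrow> x k \<noteq> 0 \<Longrightarrow> Re \<mu> < 0"
    and parity: "\<And>k. k < p \<Longrightarrow> \<sigma> k \<noteq> 0"
      "\<And>i k \<mu>. i < p \<Longrightarrow> k < p \<Longrightarrow> poly (D i k) (- \<mu>) * \<sigma> k = poly (D i k) \<mu>"
      "\<And>i k \<mu>. i < p \<Longrightarrow> k < p \<Longrightarrow> poly (S i k) (- \<mu>) * \<sigma> k = - poly (S i k) \<mu>"
    and kernel: "\<And>v. form v u = 0"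
  shows "\<exists>q. \<forall>j<p. u j = comb q j"
proof (rule ccontr)
  assume not_comb: "\<not> ?thesis"
  \<comment> \<open>\<open>P f\<close> says that f annihilates the class of u. For f of least degree
    with root \<alpha>, the multiple of u by f/(\<lambda> - \<alpha>) is a nonzero class killed by
    \<lambda> - \<alpha>.\<close>
  define P where "P f \<longleftrightarrow> f \<noteq> 0 \<and> (\<exists>q. \<forall>j<p. f * u j = comb q j)" for f
  obtain g where "P g"
    using exists_annihilator[of u] unfolding P_def by blast
  then obtain f where f: "P f" and f_min: "\<And>g. P g \<Longrightarrow> degree f \<le> degree g"
    using ex_has_least_nat[of P g degree] by blast
  then obtain q where f0: "f \<noteq> 0" and q: "\<And>j. j < p \<Longrightarrow> f * u j = comb q j"
    by (auto simp: P_def)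
  have "degree f \<noteq> 0"
  proof
    assume "degree f = 0"
    then obtain c where c: "f = [:c:]" by (rule degree_eq_zeroE)
    then have "u j = comb (\<lambda>k. smult (1 / c) (q k)) j" if "j < p" for j
      using q[OF that, symmetric] f0 by (simp add: comb_smult)
    then show False using not_comb by blast
  qed
  then obtain \<alpha> where "poly f \<alpha> = 0"
    using fundamental_theorem_of_algebra[of f] by (auto simp: constant_degree)
  then obtain g where g: "f = [:-\<alpha>, 1:] * g" by (auto simp: poly_eq_0_iff_dvd)
  have "\<not> P g"
  proof
    assume "P g"
    then have "degree f \<le> degree g" by (rule f_min)
    moreover have "degree f = degree [:-\<alpha>, 1:] + degree g"
      unfolding g using f0 g by (intro degree_mult_eq) auto
    ultimately show False by simp
  qed
  then have g_not: "\<not> (\<exists>q'. \<forall>j<p. g * u j = comb q' j)" using f0 by (auto simp: P_def g)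
  define v where "v j = g * u j" for j
  \<comment> \<open>The kernel of the form is closed under multiplication by polynomials, since g
    moves to the other slot as \<open>para g\<close>; pairing with unit vectors reads off
    \<open>out\<close>.\<close>
  have out0: "out v i = 0" if "i < p" for i
  proof -
    have "out v i = form (unit_poly i 1) (\<lambda>j. para (para g) * u j)"
      using form_unit_left[OF that, of v] by (simp add: v_def[abs_def])
    also have "\<dots> = 0" using kernel by (simp only: form_mult[symmetric])
    finally show ?thesis .
  qed
  have eig: "[:-\<alpha>, 1:] * v j = [:out v j:] + comb q j" if "j < p" for j
    using q[OF that] out0[OF that] unfolding v_def g by (simp only: mult.assoc) simp
  note ker = eigenvector_to_kernel[OF eig]
  define x where "x k = poly (q k) \<alpha>" for k
  have "\<exists>k<p. x k \<noteq> 0"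
    using ker(3) g_not by (auto simp: x_def v_def)
  then obtain k where k: "k < p" "x k \<noteq> 0" by blast
  have loop: "closed_loop \<alpha> x" using ker(1) by (simp add: x_def[abs_def])
  have Dx: "(\<Sum>k<p. poly (D i k) \<alpha> * x k) = 0" if "i < p" for i
    using ker(2)[OF _ that] out0[OF that] by (simp add: x_def)
  have Sx: "(\<Sum>k<p. poly (S i k) \<alpha> * x k) = 0" if "i < p" for i
    using loop[unfolded closed_loop_def, rule_format, OF that] Dx[OF that]
    by (simp add: distrib_right sum.distrib)
  \<comment> \<open>The factors \<open>\<sigma> k\<close> compensate the parities of the columns:
    D(-\<alpha>) sends the rescaled vector to D(\<alpha>) x, and S(-\<alpha>) sends it to -
    S(\<alpha>) x; both are 0.\<close>
  have "closed_loop (- \<alpha>) (\<lambda>k. \<sigma> k * x k)"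
    unfolding closed_loop_def
  proof (intro allI impI)
    fix i assume i: "i < p"
    have "(\<Sum>k<p. (poly (D i k) (- \<alpha>) + poly (S i k) (- \<alpha>)) * (\<sigma> k * x k))
        = (\<Sum>k<p. (poly (D i k) (- \<alpha>) * \<sigma> k) * x k + (poly (S i k) (- \<alpha>) * \<sigma> k) * x k)"
      by (simp add: algebra_simps)
    also have "\<dots> = (\<Sum>k<p. poly (D i k) \<alpha> * x k - poly (S i k) \<alpha> * x k)"
      using i by (intro sum.cong) (simp_all add: parity)
    finally show "(\<Sum>k<p. (poly (D i k) (- \<alpha>) + poly (S i k) (- \<alpha>)) * (\<sigma> k * x k)) = 0"
      by (simp add: sum_subtractf Dx[OF i] Sx[OF i])
  qed
  then have "Re (- \<alpha>) < 0"
    using k parity(1)[OF k(1)] by (intro stable[of "- \<alpha>" "\<lambda>k. \<sigma> k * x k" k]) auto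
  moreover have "Re \<alpha> < 0" using stable[OF loop k] .
  ultimately show False by simp
qed

text \<open>Coordinates on the remainders with the enumeration of monomials hidden, so that the
  matrix version of Lyapunov's theorem can be used. The last clause reflects that functions agreeing
  below p represent the same vector polynomial.\<close>

lemma small_basis:
  "\<exists>m (e :: nat \<Rightarrow> nat \<Rightarrow> complex poly) \<kappa>.
    (\<forall>a<m. small (e a)) \<and>
    (\<forall>u j. small u \<longrightarrow> j < p \<longrightarrow> u j = (\<Sum>a<m. smult (\<kappa> a u) (e a j))) \<and>
    (\<forall>a c. a < m \<longrightarrow> \<kappa> a (\<lambda>j. \<Sum>b<m. smult (c b) (e b j)) = c a) \<and>
    (\<forall>a u v. a < m \<longrightarrow> (\<forall>j<p. u j = v j) \<longrightarrow> \<kappa> a u = \<kappa> a v)"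
proof -
  define I where "I = (SIGMA j:{..<p}. {..<N j})"
  define m where "m = card I"
  have "finite I" by (simp add: I_def)
  then obtain h where h: "bij_betw h {..<m} I"
    using ex_bij_betw_nat_finite[of I] by (auto simp: m_def lessThan_atLeast0)
  define e where "e a = unit_poly (fst (h a)) (monom 1 (snd (h a)))" for a
  define \<kappa> where "\<kappa> a u = coeff (u (fst (h a))) (snd (h a))" for a and u :: "nat \<Rightarrow> complex poly"
  have hI: "fst (h a) < p" "snd (h a) < N (fst (h a))" if "a < m" for a
    using bij_betwE[OF h] that by (cases "h a"; force simp: I_def)+
  have coeff_e: "coeff (e a j) n = (if h a = (j, n) then 1 else 0)" for a j n
    by (cases "h a") (auto simp: e_def)
  have inj: "h a = h b \<longleftrightarrow> a = b" if "a < m" "b < m" for a b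
    using bij_betw_imp_inj_on[OF h] that by (auto simp: inj_on_def)
  show ?thesis
  proof (intro exI[of _ m] exI[of _ e] exI[of _ \<kappa>] conjI allI impI)
    show "small (e a)" if "a < m" for a
      using hI[OF that] by (auto simp: small_def coeff_e)
    show "\<kappa> a (\<lambda>j. \<Sum>b<m. smult (c b) (e b j)) = c a" if "a < m" for a c
    proof -
      have "\<kappa> a (\<lambda>j. \<Sum>b<m. smult (c b) (e b j)) = (\<Sum>b<m. if b = a then c b else 0)"
        unfolding \<kappa>_def coeff_sum using inj that by (intro sum.cong) (auto simp: coeff_e)
      then show ?thesis using that by simp
    qed
    show "u j = (\<Sum>a<m. smult (\<kappa> a u) (e a j))" if u: "small u" and j: "j < p" for u j
    proof (rule poly_eqI)
      fix n
      show "coeff (u j) n = coeff (\<Sum>a<m. smult (\<kappa> a u) (e a j)) n"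
      proof (cases "n < N j")
        case True
        then have "(j, n) \<in> I" using j by (simp add: I_def)
        then obtain b where b: "b < m" "h b = (j, n)"
          using bij_betw_imp_surj_on[OF h] by (metis imageE lessThan_iff)
        have "coeff (\<Sum>a<m. smult (\<kappa> a u) (e a j)) n = (\<Sum>a<m. if a = b then \<kappa> a u else 0)"
          unfolding coeff_sum using inj b by (intro sum.cong) (auto simp: coeff_e simp flip: b(2))
        then show ?thesis using b by (simp add: \<kappa>_def)
      next
        case False
        then have "h a \<noteq> (j, n)" if "a < m" for a
          using hI[OF that] by auto
        then have "coeff (\<Sum>a<m. smult (\<kappa> a u) (e a j)) n = 0"
          unfolding coeff_sum by (intro sum.neutral) (auto simp: coeff_e)
        then show ?thesis using u j False by (simp add: small_def)
      qed
    qed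
    show "\<kappa> a u = \<kappa> a v" if "a < m" "\<forall>j<p. u j = v j" for a u v
      using that hI by (simp add: \<kappa>_def)
  qed
qed

text \<open>\<open>A\<close> is the matrix on remainders of u \<mapsto> \<lambda> u - out u, reduced
  modulo the columns. The energy balance makes \<open>A\<close> dissipative for the Gram matrix of
  the form.\<close>

lemma form_nonneg_if_stable:
  assumes h: hermitian_functional
    and stable: "\<And>\<mu> x k. closed_loop \<mu> x \<Longrightarrow> k < p \<Longrightarrow> x k \<noteq> 0 \<Longrightarrow> Re \<mu> < 0"
  shows "0 \<le> Re (form u u)"
proof -
  obtain m and e :: "nat \<Rightarrow> nat \<Rightarrow> complex poly" and \<kappa> where basis: "\<forall>a<m. small (e a)"
      "\<forall>u j. small u \<longrightarrow> j < p \<longrightarrow> u j = (\<Sum>a<m. smult (\<kappa> a u) (e a j))"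
      "\<forall>a c. a < m \<longrightarrow> \<kappa> a (\<lambda>j. \<Sum>b<m. smult (c b) (e b j)) = c a"
      "\<forall>a u v. a < m \<longrightarrow> (\<forall>j<p. u j = v j) \<longrightarrow> \<kappa> a u = \<kappa> a v"
    using small_basis by (elim exE conjE)
  note e = basis(1)[rule_format] and expand = basis(2)[rule_format]
    and \<kappa> = basis(3)[rule_format] and \<kappa>_cong = basis(4)[rule_format]
  define pv where "pv v j = (\<Sum>a<m. smult (v $ a) (e a j))" for v j
  have pv_small: "small (pv v)" for v
    unfolding pv_def[abs_def] using e by (intro small_sum small_smult) auto
  have "\<exists>q r. small r \<and> (\<forall>j<p. [:0, 1:] * e a j - [:out (e a) j:] = r j + comb q j)" for a
    by (rule division)
  then obtain qa ra where ra: "\<And>a. small (ra a)"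
    and qa: "\<And>a j. j < p \<Longrightarrow> [:0, 1:] * e a j - [:out (e a) j:] = ra a j + comb (qa a) j"
    by metis
  define A where "A = mat m m (\<lambda>(b, a). \<kappa> b (ra a))"
  have A: "A \<in> carrier_mat m m" by (simp add: A_def)
  define q where "q v k = (\<Sum>a<m. smult (v $ a) (qa a k))" for v k
  have out_pv: "out (pv v) j = (\<Sum>a<m. v $ a * out (e a) j)" for v j
  proof -
    have "out (pv v) j = (\<Sum>i<p. \<Sum>a<m. v $ a * L j i (e a i))"
      by (simp add: out_def pv_def L_sum L_smult)
    also have "\<dots> = (\<Sum>a<m. \<Sum>i<p. v $ a * L j i (e a i))" by (rule sum.swap)
    finally show ?thesis by (simp add: out_def sum_distrib_left)
  qed
  have step: "[:0, 1:] * pv v j = pv (A *\<^sub>v v) j + comb (q v) j + [:out (pv v) j:]"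
    if v: "v \<in> carrier_vec m" and j: "j < p" for v j
  proof -
    have "[:0, 1:] * pv v j = (\<Sum>a<m. smult (v $ a) ([:0, 1:] * e a j))"
      unfolding pv_def sum_distrib_left by simp
    also have "\<dots> = (\<Sum>a<m. smult (v $ a) (ra a j) + smult (v $ a) (comb (qa a) j) + [:v $ a * out (e a) j:])"
    proof (intro sum.cong refl)
      fix a
      have "[:0, 1:] * e a j = ra a j + comb (qa a) j + [:out (e a) j:]"
        using qa[OF j, of a] by (simp only: diff_eq_eq)
      then show "smult (v $ a) ([:0, 1:] * e a j)
          = smult (v $ a) (ra a j) + smult (v $ a) (comb (qa a) j) + [:v $ a * out (e a) j:]"
        by (simp only: smult_add_right smult_pCons smult_0_right)
    qed
    also have "\<dots> = (\<Sum>a<m. smult (v $ a) (ra a j)) + comb (q v) j + [:out (pv v) j:]"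
      unfolding sum.distrib q_def[abs_def] comb_sum comb_smult out_pv sum_const_poly ..
    also have "(\<Sum>a<m. smult (v $ a) (ra a j)) = pv (A *\<^sub>v v) j"
    proof -
      have "(\<Sum>a<m. smult (v $ a) (ra a j)) = (\<Sum>a<m. smult (v $ a) (\<Sum>b<m. smult (\<kappa> b (ra a)) (e b j)))"
        using expand[OF ra j] by simp
      also have "\<dots> = (\<Sum>a<m. \<Sum>b<m. smult (\<kappa> b (ra a) * v $ a) (e b j))"
        by (simp add: smult_sum2 mult_ac)
      also have "\<dots> = (\<Sum>b<m. \<Sum>a<m. smult (\<kappa> b (ra a) * v $ a) (e b j))"
        by (rule sum.swap)
      also have "\<dots> = pv (A *\<^sub>v v) j"
        unfolding pv_def
        using v by (intro sum.cong) (auto simp: A_def scalar_prod_def smult_sum lessThan_atLeast0)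
      finally show ?thesis .
    qed
    finally show ?thesis .
  qed
  have pv_0: "v = 0\<^sub>v m" if "v \<in> carrier_vec m" "\<And>j. j < p \<Longrightarrow> pv v j = 0" for v
  proof (intro eq_vecI)
    fix a assume a: "a < dim_vec (0\<^sub>v m)"
    have "v $ a = \<kappa> a (pv v)" using \<kappa>[of a "\<lambda>b. v $ b"] a by (simp add: pv_def[abs_def])
    also have "\<dots> = \<kappa> a (\<lambda>j. \<Sum>b<m. smult 0 (e b j))"
      using that(2) a by (intro \<kappa>_cong) auto
    also have "\<dots> = 0" using \<kappa>[of a "\<lambda>b. 0"] a by simp
    finally show "v $ a = 0\<^sub>v m $ a" using a by simp
  qed (use that in auto)
  define G where "G a b = form (e a) (e b)" for a b
  have gram: "gram_form m G v w = form (pv v) (pv w)" for v w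
    unfolding pv_def[abs_def] form_sum_left form_smult_left form_sum_right form_smult_right
    by (simp add: gram_form_def G_def sum_distrib_left mult_ac)
  have nonneg: "0 \<le> Re (gram_form m G v v)" if "v \<in> carrier_vec m" for v
  proof (rule lyapunov_nonneg[OF A _ _ _ that])
    show "G b a = cnj (G a b)" for a b
      unfolding G_def by (rule form_swap[OF h])
    show "Re (gram_form m G v (A *\<^sub>v v)) \<le> 0" if v: "v \<in> carrier_vec m" for v
    proof -
      have "form (pv v) (\<lambda>j. [:0, 1:] * pv v j)
          = form (pv v) (\<lambda>j. pv (A *\<^sub>v v) j + comb (q v) j + [:out (pv v) j:])"
        using step[OF v] by (intro form_cong) auto
      also have "\<dots> = form (pv v) (pv (A *\<^sub>v v)) + of_real (\<Sum>i<p. (norm (out (pv v) i))\<^sup>2)"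
        unfolding form_add_right form_comb_right form_const_right[OF h] by simp
      finally have "Re (form (pv v) (pv (A *\<^sub>v v))) + (\<Sum>i<p. (norm (out (pv v) i))\<^sup>2) = 0"
        using form_X_skew[OF h, of "pv v"] by simp
      moreover have "0 \<le> (\<Sum>i<p. (norm (out (pv v) i))\<^sup>2)" by (intro sum_nonneg) simp
      ultimately show ?thesis unfolding gram by linarith
    qed
    show "Re \<alpha> < 0" if v: "v \<in> carrier_vec m" "v \<noteq> 0\<^sub>v m" "A *\<^sub>v v = \<alpha> \<cdot>\<^sub>v v" for \<alpha> v
    proof -
      have pvA: "pv (A *\<^sub>v v) j = smult \<alpha> (pv v j)" for j
        unfolding v(3) pv_def using v(1) by (simp add: smult_sum2)
      have eig: "[:-\<alpha>, 1:] * pv v j = [:out (pv v) j:] + comb (q v) j" if "j < p" for j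
        using step[OF v(1) that] unfolding pvA by (simp add: algebra_simps)
      note ker = eigenvector_to_kernel[OF eig]
      \<comment> \<open>The vector q(\<alpha>) is the kernel vector that stability needs. If it were
        zero, the eigenvector would be a remainder in the column module, hence zero.\<close>
      have "\<exists>k<p. poly (q v k) \<alpha> \<noteq> 0"
      proof (rule ccontr)
        assume "\<not> ?thesis"
        then obtain q' where q': "\<And>j. j < p \<Longrightarrow> pv v j = comb q' j" using ker(3) by blast
        then have "small (comb q')" using pv_small[of v] by (simp add: small_def)
        then have "q' k = 0" if "k < p" for k using small_comb_imp_zero that by blast
        then have "comb q' j = 0" for j by (simp add: comb_def)
        then show False using pv_0[OF v(1)] q' v(2) by simp
      qed
      then show ?thesis using stable[OF ker(1)] by blast
    qed
  qed
  obtain q' r where r: "small r" "\<And>j. j < p \<Longrightarrow> u j = r j + comb q' j"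
    using division[of u] by blast
  have "form u u = form (\<lambda>j. r j + comb q' j) (\<lambda>j. r j + comb q' j)"
    using r by (intro form_cong) auto
  also have "\<dots> = form r r"
    unfolding form_add_left form_add_right form_comb_left[OF h] form_comb_right by simp
  also have "\<dots> = form (pv (vec m (\<lambda>a. \<kappa> a r))) (pv (vec m (\<lambda>a. \<kappa> a r)))"
    using expand[OF r(1)] by (intro form_cong) (simp_all add: pv_def)
  finally show ?thesis using nonneg[of "vec m (\<lambda>a. \<kappa> a r)"] by (simp add: gram)
qed

text \<open>A null vector of a semidefinite form lies in its kernel, hence in the column module,
  whose only remainder is 0.\<close>

lemma form_positive_if_stable:
  assumes h: hermitian_functional
    and stable: "\<And>\<mu> x k. closed_loop \<mu> x \<Longrightarrow> k < p \<Longrightarrow> x k \<noteq> 0 \<Longrightarrow> Re \<mu> < 0"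
    and parity: "\<And>k. k < p \<Longrightarrow> \<sigma> k \<noteq> 0"
      "\<And>i k \<mu>. i < p \<Longrightarrow> k < p \<Longrightarrow> poly (D i k) (- \<mu>) * \<sigma> k = poly (D i k) \<mu>"
      "\<And>i k \<mu>. i < p \<Longrightarrow> k < p \<Longrightarrow> poly (S i k) (- \<mu>) * \<sigma> k = - poly (S i k) \<mu>"
    and u: "small u" "j < p" "u j \<noteq> 0"
  shows "0 < Re (form u u)"
proof (rule ccontr)
  have nonneg: "0 \<le> Re (form v v)" for v
    by (rule form_nonneg_if_stable[OF h]) (rule stable)
  assume "\<not> ?thesis"
  then have "Re (form u u) = 0" using nonneg[of u] by linarith
  then have "form u v = 0" for v
    by (rule form_kernel_if_isotropic[OF h nonneg])
  then have "form v u = 0" for v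
    by (subst form_swap[OF h]) simp
  then obtain q where q: "\<And>j. j < p \<Longrightarrow> u j = comb q j"
    using form_nondegenerate_if_stable[of \<sigma> u] stable parity by blast
  then have "small (comb q)" using u(1) by (simp add: small_def)
  then have "q k = 0" if "k < p" for k using small_comb_imp_zero that by blast
  then have "comb q j = 0" by (simp add: comb_def)
  then show False using q[OF u(2)] u(3) by simp
qed

end

section \<open>Positive definiteness of block Hankel matrices\<close>

lemma quadratic_form_eq_gram_form:
  assumes "H \<in> carrier_mat n n" "v \<in> carrier_vec n"
  shows "(H *\<^sub>v v) \<bullet>c v = gram_form n (\<lambda>a b. H $$ (a, b)) v v"
proof -
  have "(H *\<^sub>v v) \<bullet>c v = (\<Sum>a<n. (\<Sum>b<n. H $$ (a, b) * v $ b) * cnj (v $ a))"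
    using assms by (auto simp: scalar_prod_def lessThan_atLeast0 intro!: sum.cong)
  then show ?thesis
    by (simp add: gram_form_def sum_distrib_right sum_distrib_left mult_ac)
qed

lemma hermitian_iff:
  assumes "H \<in> carrier_mat n n"
  shows "hermitian H \<longleftrightarrow> (\<forall>a<n. \<forall>b<n. H $$ (b, a) = cnj (H $$ (a, b)))"
proof -
  have adj: "mat_adjoint H \<in> carrier_mat n n" "\<And>a b. a < n \<Longrightarrow> b < n \<Longrightarrow> mat_adjoint H $$ (a, b) = cnj (H $$ (b, a))"
    using assms by (auto simp: mat_adjoint_def mat_of_rows_def)
  show ?thesis
  proof
    assume "hermitian H"
    then have "mat_adjoint H = H" by (simp add: hermitian_def)
    then show "\<forall>a<n. \<forall>b<n. H $$ (b, a) = cnj (H $$ (a, b))" using adj(2) by metis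
  next
    assume *: "\<forall>a<n. \<forall>b<n. H $$ (b, a) = cnj (H $$ (a, b))"
    show "hermitian H"
      unfolding hermitian_def
    proof (rule eq_matI)
      fix a b assume "a < dim_row H" "b < dim_col H"
      then have ab: "a < n" "b < n" using assms by auto
      show "mat_adjoint H $$ (a, b) = H $$ (a, b)"
        using adj(2)[OF ab] *[rule_format, OF ab(2) ab(1)] by simp
    qed (use assms adj(1) in auto)
  qed
qed

text \<open>Passing from row numbers to an arbitrary index set \<open>J\<close> removes the ordering
  of the rows from all later arguments. The real part suffices on the right because a Hermitian form
  takes real values.\<close>

lemma positive_definite_iff_kernel:
  assumes H: "H \<in> carrier_mat n n"
    and \<phi>: "bij_betw \<phi> {..<n} J"
    and HK: "\<And>a b. a < n \<Longrightarrow> b < n \<Longrightarrow> H $$ (a, b) = K (\<phi> a) (\<phi> b)"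
    and K: "\<And>s t. s \<in> J \<Longrightarrow> t \<in> J \<Longrightarrow> K t s = cnj (K s t)"
  shows "positive_definite H \<longleftrightarrow>
    (\<forall>x. (\<exists>s\<in>J. x s \<noteq> 0) \<longrightarrow> 0 < Re (\<Sum>s\<in>J. \<Sum>t\<in>J. cnj (x s) * K s t * x t))"
proof -
  have \<phi>J: "\<phi> a \<in> J" if "a < n" for a using bij_betwE[OF \<phi>] that by auto
  have herm: "H $$ (b, a) = cnj (H $$ (a, b))" if "a < n" "b < n" for a b
    unfolding HK[OF that] HK[OF that(2,1)] using K \<phi>J that by blast
  have hermH: "hermitian H" using herm hermitian_iff[OF H] by blast
  have sq: "square_mat H" using H by auto
  have Im0: "Im ((H *\<^sub>v v) \<bullet>c v) = 0" if v: "v \<in> carrier_vec n" for v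
  proof -
    have "gram_form n (\<lambda>a b. H $$ (a, b)) v v = cnj (gram_form n (\<lambda>a b. H $$ (a, b)) v v)"
      by (rule gram_form_swap) (rule herm)
    then show ?thesis
      unfolding quadratic_form_eq_gram_form[OF H v] by (simp add: complex_eq_iff)
  qed
  have form: "(H *\<^sub>v v) \<bullet>c v = (\<Sum>s\<in>J. \<Sum>t\<in>J. cnj (x s) * K s t * x t)"
    if v: "v \<in> carrier_vec n" and x: "\<And>a. a < n \<Longrightarrow> v $ a = x (\<phi> a)" for v x
  proof -
    have "(H *\<^sub>v v) \<bullet>c v = (\<Sum>a<n. \<Sum>b<n. cnj (x (\<phi> a)) * K (\<phi> a) (\<phi> b) * x (\<phi> b))"
      unfolding quadratic_form_eq_gram_form[OF H v] gram_form_def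
      by (intro sum.cong) (auto simp: x HK)
    also have "\<dots> = (\<Sum>a<n. \<Sum>t\<in>J. cnj (x (\<phi> a)) * K (\<phi> a) t * x t)"
      by (intro sum.cong refl sum.reindex_bij_betw[OF \<phi>])
    also have "\<dots> = (\<Sum>s\<in>J. \<Sum>t\<in>J. cnj (x s) * K s t * x t)"
      by (rule sum.reindex_bij_betw[OF \<phi>, of "\<lambda>s. \<Sum>t\<in>J. cnj (x s) * K s t * x t"])
    finally show ?thesis .
  qed
  show ?thesis
  proof
    assume pd: "positive_definite H"
    show "\<forall>x. (\<exists>s\<in>J. x s \<noteq> 0) \<longrightarrow> 0 < Re (\<Sum>s\<in>J. \<Sum>t\<in>J. cnj (x s) * K s t * x t)"
    proof (intro allI impI)
      fix x :: "'a \<Rightarrow> complex" assume "\<exists>s\<in>J. x s \<noteq> 0"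
      then obtain a where a: "a < n" "x (\<phi> a) \<noteq> 0"
        using bij_betw_imp_surj_on[OF \<phi>] by (metis imageE lessThan_iff)
      define v where "v = vec n (\<lambda>a. x (\<phi> a))"
      have v: "v \<in> carrier_vec n" by (simp add: v_def)
      have "v \<noteq> 0\<^sub>v n"
      proof
        assume "v = 0\<^sub>v n"
        then have "v $ a = 0" using a by simp
        then show False using a by (simp add: v_def)
      qed
      then have "0 < (H *\<^sub>v v) \<bullet>c v" using pd v H by (auto simp: positive_definite_def)
      then show "0 < Re (\<Sum>s\<in>J. \<Sum>t\<in>J. cnj (x s) * K s t * x t)"
        by (subst form[OF v, symmetric]) (auto simp: v_def less_complex_def)
    qed
  next
    assume pos: "\<forall>x. (\<exists>s\<in>J. x s \<noteq> 0) \<longrightarrow> 0 < Re (\<Sum>s\<in>J. \<Sum>t\<in>J. cnj (x s) * K s t * x t)"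
    show "positive_definite H"
      unfolding positive_definite_def
    proof (intro conjI ballI impI sq hermH)
      fix v :: "complex Matrix.vec" assume "v \<in> carrier_vec (dim_row H)" "v \<noteq> 0\<^sub>v (dim_row H)"
      then have v: "v \<in> carrier_vec n" "v \<noteq> 0\<^sub>v n" using H by auto
      define x where "x s = v $ (the_inv_into {..<n} \<phi> s)" for s
      have x: "v $ a = x (\<phi> a)" if "a < n" for a
        using bij_betw_imp_inj_on[OF \<phi>] that by (simp add: x_def the_inv_into_f_f)
      have "\<exists>a<n. v $ a \<noteq> 0"
      proof (rule ccontr)
        assume "\<not> ?thesis"
        then have "v = 0\<^sub>v n" using v(1) by (intro eq_vecI) auto
        then show False using v(2) by simp
      qed
      then obtain a where a: "a < n" "x (\<phi> a) \<noteq> 0" using x by auto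
      have "(H *\<^sub>v v) \<bullet>c v = (\<Sum>s\<in>J. \<Sum>t\<in>J. cnj (x s) * K s t * x t)"
        by (rule form[OF v(1)]) (rule x)
      moreover have "0 < Re (\<Sum>s\<in>J. \<Sum>t\<in>J. cnj (x s) * K s t * x t)"
        by (rule pos[rule_format]) (use a \<phi>J in blast)
      ultimately have "0 < Re ((H *\<^sub>v v) \<bullet>c v)" by simp
      then show "0 < (H *\<^sub>v v) \<bullet>c v" using Im0[OF v(1)] by (simp add: less_complex_def)
    qed
  qed
qed

lemma block_indices_bij:
  "bij_betw (\<lambda>a. block_indices n r ! a) {..<length (block_indices n r)} (SIGMA i:{..<n}. {..<r i})"
proof (rule bij_betw_nth)
  show "distinct (block_indices n r)"
    unfolding block_indices_def
  proof (induction n)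
    case (Suc n)
    then show ?case by (auto simp: distinct_map inj_on_def)
  qed simp
  show "(SIGMA i:{..<n}. {..<r i}) = set (block_indices n r)"
    by (auto simp: block_indices_def)
qed simp

lemma pick_bij:
  assumes "finite S"
  shows "bij_betw (pick S) {..<card S} S"
proof -
  have inj: "inj_on (pick S) {..<card S}"
  proof (rule linorder_inj_onI')
    fix a b assume "a \<in> {..<card S}" "b \<in> {..<card S}" "a < b"
    then have "pick S a < pick S b" using pick_mono_le[of b S a] by simp
    then show "pick S a \<noteq> pick S b" by simp
  qed
  have "pick S ` {..<card S} \<subseteq> S"
    using pick_in_set_le by auto
  moreover have "card (pick S ` {..<card S}) = card S"
    using card_image[OF inj] by simp
  ultimately have "pick S ` {..<card S} = S"
    using assms by (simp add: card_subset_eq)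
  then show ?thesis using inj by (simp add: bij_betw_def)
qed

lemma positive_definite_block_hankel_iff:
  fixes M :: "nat \<Rightarrow> complex mat" and I :: "nat \<Rightarrow> nat set"
  assumes M: "\<And>k. M k \<in> carrier_mat p p" and I: "\<And>i. I i \<subseteq> {..<p}"
    and herm: "\<And>i j. i < n \<Longrightarrow> j < n \<Longrightarrow> hermitian (M (i + j))"
  defines "J \<equiv> SIGMA i:{..<n}. I i"
  shows "positive_definite (block_mat n (\<lambda>i j. submatrix (M (i + j)) (I i) (I j))) \<longleftrightarrow>
    (\<forall>x. (\<exists>s\<in>J. x s \<noteq> 0) \<longrightarrow>
      0 < Re (\<Sum>(i, k)\<in>J. \<Sum>(j, l)\<in>J. cnj (x (i, k)) * M (i + j) $$ (k, l) * x (j, l)))"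
proof -
  define B where "B i j = submatrix (M (i + j)) (I i) (I j)" for i j
  define rs where "rs = block_indices n (\<lambda>i. card (I i))"
  have card: "card {k. k < p \<and> k \<in> I i} = card (I i)" for i
    using I[of i] by (intro arg_cong[of _ _ card]) auto
  have dims: "dim_row (B i j) = card (I i)" "dim_col (B i j) = card (I j)" for i j
    using M[of "i + j"] by (auto simp: B_def dim_submatrix card)
  \<comment> \<open>\<open>block_mat\<close> takes row sizes from the blocks \<open>B i 0\<close>
    and column sizes from \<open>B 0 j\<close>; by \<open>dims\<close> both position lists are the
    same.\<close>
  have H: "block_mat n B = mat (length rs) (length rs)
      (\<lambda>(a, b). B (fst (rs ! a)) (fst (rs ! b)) $$ (snd (rs ! a), snd (rs ! b)))"
    by (simp add: block_mat_def dims rs_def Let_def)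
  define \<psi> where "\<psi> = (\<lambda>(i, u). (i, pick (I i) u))"
  define \<phi> where "\<phi> a = \<psi> (rs ! a)" for a
  have "bij_betw \<psi> (SIGMA i:{..<n}. {..<card (I i)}) J"
  proof -
    have pick: "bij_betw (pick (I i)) {..<card (I i)} (I i)" for i
      using I finite_subset by (intro pick_bij) blast
    show ?thesis
      unfolding bij_betw_def
    proof
      show "inj_on \<psi> (SIGMA i:{..<n}. {..<card (I i)})"
        using bij_betw_imp_inj_on[OF pick] by (auto simp: \<psi>_def inj_on_def)
      show "\<psi> ` (SIGMA i:{..<n}. {..<card (I i)}) = J"
        using bij_betw_imp_surj_on[OF pick] unfolding \<psi>_def J_def by (auto simp: image_iff) blast+
    qed
  qed
  then have \<phi>: "bij_betw \<phi> {..<length rs} J"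
    using bij_betw_trans[OF block_indices_bij[of n "\<lambda>i. card (I i)"]]
    by (simp add: \<phi>_def[abs_def] rs_def comp_def)
  define K where "K s t = M (fst s + fst t) $$ (snd s, snd t)" for s t :: "nat \<times> nat"
  have HK: "block_mat n B $$ (a, b) = K (\<phi> a) (\<phi> b)" if "a < length rs" "b < length rs" for a b
  proof -
    have rsI: "rs ! c \<in> (SIGMA i:{..<n}. {..<card (I i)})" if "c < length rs" for c
      using bij_betwE[OF block_indices_bij[of n "\<lambda>i. card (I i)"]] that by (simp add: rs_def)
    obtain i u where a: "rs ! a = (i, u)" by fastforce
    obtain j w where b: "rs ! b = (j, w)" by fastforce
    have "u < card (I i)" "w < card (I j)"
      using rsI[OF that(1)] rsI[OF that(2)] by (auto simp: a b)
    then have "B i j $$ (u, w) = M (i + j) $$ (pick (I i) u, pick (I j) w)"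
      unfolding B_def using M[of "i + j"] by (intro submatrix_index) (auto simp: card)
    then show ?thesis
      using that by (simp add: H a b K_def \<phi>_def \<psi>_def)
  qed
  have KJ: "K t s = cnj (K s t)" if "s \<in> J" "t \<in> J" for s t
  proof -
    obtain i k j l where st: "s = (i, k)" "t = (j, l)" by fastforce
    have ij: "i < n" "j < n" "k < p" "l < p"
      using that I[of i] I[of j] by (auto simp: st J_def)
    show ?thesis
      using herm[OF ij(1,2), unfolded hermitian_iff[OF M], rule_format, OF ij(3,4)]
      by (simp add: K_def st add.commute[of j i])
  qed
  have "positive_definite (block_mat n B) \<longleftrightarrow>
      (\<forall>x. (\<exists>s\<in>J. x s \<noteq> 0) \<longrightarrow> 0 < Re (\<Sum>s\<in>J. \<Sum>t\<in>J. cnj (x s) * K s t * x t))"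
    by (rule positive_definite_iff_kernel[OF _ \<phi> HK KJ]) (simp_all add: H)
  then show ?thesis
    unfolding B_def[abs_def] K_def by (simp add: split_beta)
qed

section \<open>Expansions at infinity\<close>

text \<open>The series variable is w = 1/\<lambda>, so the coefficient of \<lambda>^n sits at index
  -n.\<close>

definition fls_at_infinity :: "complex poly \<Rightarrow> complex fls" where
  "fls_at_infinity f = (\<Sum>n\<le>degree f. fls_const (coeff f n) * fls_X_inv ^ n)"

lemma fls_nth_at_infinity:
  "fls_nth (fls_at_infinity f) m = (if m \<le> 0 then coeff f (nat (- m)) else 0)"
proof -
  have "fls_nth (fls_at_infinity f) m = (\<Sum>n\<le>degree f. if m = - int n then coeff f n else 0)"
    by (simp add: fls_at_infinity_def fls_nth_sum if_distrib cong: if_cong)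
  also have "\<dots> = (if m \<le> 0 then coeff f (nat (- m)) else 0)"
  proof (cases "m \<le> 0")
    case True
    then have "(\<Sum>n\<le>degree f. if m = - int n then coeff f n else 0)
        = (\<Sum>n\<le>degree f. if n = nat (- m) then coeff f n else 0)"
      by (intro sum.cong) auto
    then show ?thesis using True by (simp add: coeff_eq_0)
  qed auto
  finally show ?thesis .
qed

lemma fls_at_infinity_expansion: "(\<lambda>w. poly f (1 / w)) has_laurent_expansion fls_at_infinity f"
proof -
  have "(\<lambda>w. \<Sum>n\<le>degree f. coeff f n * inverse w ^ n) has_laurent_expansion fls_at_infinity f"
    unfolding fls_at_infinity_def by (intro laurent_expansion_intros)
  then show ?thesis by (simp add: poly_altdef divide_inverse)
qed

lemma fls_at_infinity_add: "fls_at_infinity (f + g) = fls_at_infinity f + fls_at_infinity g"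
  by (rule fls_eqI) (simp add: fls_nth_at_infinity)

lemma fls_at_infinity_0 [simp]: "fls_at_infinity 0 = 0"
  by (rule fls_eqI) (simp add: fls_nth_at_infinity)

lemma fls_at_infinity_mult: "fls_at_infinity (f * g) = fls_at_infinity f * fls_at_infinity g"
proof -
  have "(\<lambda>w. poly f (1 / w) * poly g (1 / w)) has_laurent_expansion fls_at_infinity f * fls_at_infinity g"
    by (intro laurent_expansion_intros fls_at_infinity_expansion)
  then show ?thesis
    using fls_at_infinity_expansion[of "f * g"] by (auto intro: has_laurent_expansion_unique)
qed

lemma fls_at_infinity_const: "fls_at_infinity [:c:] = fls_const c"
  by (rule fls_eqI) (auto simp: fls_nth_at_infinity coeff_eq_0)

lemma fls_at_infinity_smult: "fls_at_infinity (smult c f) = fls_const c * fls_at_infinity f"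
  using fls_at_infinity_mult[of "[:c:]" f] by (simp add: fls_at_infinity_const)

lemma fls_at_infinity_X: "fls_at_infinity [:0, 1:] = fls_X_inv"
  by (rule fls_eqI) (auto simp: fls_nth_at_infinity coeff_pCons split: nat.splits)

lemma fls_X_times_at_infinity_X: "fls_X * fls_at_infinity ([:0, 1:] * f) = fls_at_infinity f"
  unfolding fls_at_infinity_mult fls_at_infinity_X by (simp add: fls_X_times_conv_shift fls_X_inv_times_conv_shift)

lemma fls_at_infinity_eq_0_iff: "fls_at_infinity f = 0 \<longleftrightarrow> f = 0"
proof
  assume "fls_at_infinity f = 0"
  then have "coeff f n = 0" for n
    using fls_nth_at_infinity[of f "- int n"] by simp
  then show "f = 0" by (simp add: poly_eq_iff)
qed simp

lemma fls_at_infinity_square: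
  "fls_at_infinity (pcompose f (monom 1 2)) = fls_compose_power (fls_at_infinity f) 2"
proof (rule fls_eqI)
  fix m :: int
  show "fls_nth (fls_at_infinity (pcompose f (monom 1 2))) m = fls_nth (fls_compose_power (fls_at_infinity f) 2) m"
  proof (cases "m \<le> 0")
    case True
    then obtain n where n: "m = - int n" by (metis nat_0_le neg_0_le_iff_le minus_minus)
    have "nat (- (- int n div 2)) = n div 2" if "even n"
      using that by (auto elim!: evenE)
    then show ?thesis
      by (auto simp: n fls_nth_at_infinity coeff_pcompose_square fls_nth_compose_power)
  next
    case False
    then show ?thesis by (auto simp: fls_nth_at_infinity fls_nth_compose_power)
  qed
qed

lemma fls_nth_times_at_infinity:
  assumes "degree f \<le> d"
  shows "fls_nth (g * fls_at_infinity f) m = (\<Sum>n\<le>d. fls_nth g (m + int n) * coeff f n)"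
proof -
  have "g * fls_at_infinity f = (\<Sum>n\<le>degree f. fls_const (coeff f n) * (fls_X_inv ^ n * g))"
    by (simp add: fls_at_infinity_def sum_distrib_left mult_ac)
  then have "fls_nth (g * fls_at_infinity f) m = (\<Sum>n\<le>degree f. fls_nth g (m + int n) * coeff f n)"
    by (simp add: fls_nth_sum fls_X_inv_power_times_conv_shift mult.commute)
  also have "\<dots> = (\<Sum>n\<le>d. fls_nth g (m + int n) * coeff f n)"
    using assms by (intro sum.mono_neutral_left) (auto simp: coeff_eq_0)
  finally show ?thesis .
qed

section \<open>Matrix polynomials with triangular leading coefficients\<close>

locale triangular_mat_poly =
  fixes F :: "complex poly mat" and p :: nat
  assumes F: "F \<in> carrier_mat p p"
    and reduced: "column_reduced F" and triangular: "upper_triangular (hcdc F)"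
begin

section \<open>Leading coefficients and degrees of the dominant and subordinated parts\<close>

lemma degree_le_cdeg: "i < p \<Longrightarrow> degree (F $$ (i, k)) \<le> cdeg F k"
  unfolding cdeg_def using F by (intro Max_ge) auto

lemma hcdc_index: "i < p \<Longrightarrow> k < p \<Longrightarrow> hcdc F $$ (i, k) = coeff (F $$ (i, k)) (cdeg F k)"
  using F by (simp add: hcdc_def)

lemma lower_coeff: "i < p \<Longrightarrow> k < i \<Longrightarrow> coeff (F $$ (i, k)) (cdeg F k) = 0"
  using triangular F hcdc_index[of i k] by (auto simp: upper_triangular_def hcdc_def)

lemma diag_coeff:
  assumes k: "k < p"
  shows "coeff (F $$ (k, k)) (cdeg F k) \<noteq> 0"
proof
  assume "coeff (F $$ (k, k)) (cdeg F k) = 0"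
  then have "hcdc F $$ (k, k) = 0" using hcdc_index k by simp
  then have "0 \<in> set (diag_mat (hcdc F))"
    using k F by (force simp: diag_mat_def hcdc_def)
  moreover have "hcdc F \<in> carrier_mat p p" using F by (auto simp: hcdc_def)
  ultimately have "Determinant.det (hcdc F) = 0"
    by (simp add: det_upper_triangular[OF triangular] prod_list_zero_iff)
  then show False using reduced by (simp add: column_reduced_def)
qed

abbreviation "Fd \<equiv> dominant_part F"
abbreviation "Fs \<equiv> subordinated_part F"

lemma Fd_carrier: "Fd \<in> carrier_mat p p" and Fs_carrier: "Fs \<in> carrier_mat p p"
  using F by (auto simp: dominant_part_def subordinated_part_def)

lemma coeff_Fd:
  "i < p \<Longrightarrow> k < p \<Longrightarrow> coeff (Fd $$ (i, k)) n = coeff (F $$ (i, k)) (2 * n + cdeg F k mod 2)"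
  using F by (auto simp: dominant_part_def coeff_even_part coeff_odd_part mod2_eq_if)

lemma coeff_Fd_top:
  "i < p \<Longrightarrow> k < p \<Longrightarrow> coeff (Fd $$ (i, k)) (cdeg F k div 2) = coeff (F $$ (i, k)) (cdeg F k)"
  by (simp add: coeff_Fd)

lemma degree_Fd: "i < p \<Longrightarrow> k < p \<Longrightarrow> degree (Fd $$ (i, k)) \<le> cdeg F k div 2"
  using degree_le_cdeg[of i k] by (intro degree_le) (auto simp: coeff_Fd coeff_eq_0)

lemma degree_Fs: "i < p \<Longrightarrow> k < p \<Longrightarrow> degree (Fs $$ (i, k)) \<le> cdeg F k div 2"
proof (intro degree_le allI impI)
  fix n assume ik: "i < p" "k < p" and n: "cdeg F k div 2 < n"
  show "coeff (Fs $$ (i, k)) n = 0"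
    using degree_le_cdeg[OF ik(1), of k] n ik F
    by (cases n) (auto simp: subordinated_part_def coeff_even_part coeff_odd_part coeff_pCons intro!: coeff_eq_0)
qed

lemma cdeg_Fd:
  assumes k: "k < p"
  shows "cdeg Fd k = cdeg F k div 2"
  unfolding cdeg_def[of Fd]
proof (rule Max_eqI)
  show "y \<le> cdeg F k div 2" if "y \<in> {degree (Fd $$ (i, k)) |i. i < dim_row Fd}" for y
    using that degree_Fd k Fd_carrier by auto
  have "cdeg F k div 2 \<le> degree (Fd $$ (k, k))"
    using diag_coeff[OF k] by (intro le_degree) (simp add: coeff_Fd_top k)
  then have "cdeg F k div 2 = degree (Fd $$ (k, k))"
    using degree_Fd[OF k k] by simp
  then show "cdeg F k div 2 \<in> {degree (Fd $$ (i, k)) |i. i < dim_row Fd}"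
    using k Fd_carrier by auto
qed simp

sublocale columns_Fd: column_module p "\<lambda>k. cdeg F k div 2" "\<lambda>i k. Fd $$ (i, k)"
  by unfold_locales (simp_all add: degree_Fd coeff_Fd_top lower_coeff diag_coeff)

lemma det_F_nonzero: "Determinant.det F \<noteq> 0"
proof -
  interpret column_module p "cdeg F" "\<lambda>i k. F $$ (i, k)"
    by unfold_locales (simp_all add: degree_le_cdeg lower_coeff diag_coeff)
  have "mat p p (\<lambda>(i, k). F $$ (i, k)) = F" using F by (intro eq_matI) auto
  then show ?thesis using det_nonzero by simp
qed

lemma det_Fd_nonzero: "Determinant.det Fd \<noteq> 0"
proof -
  have "mat p p (\<lambda>(i, k). Fd $$ (i, k)) = Fd" using Fd_carrier by (intro eq_matI) auto
  then show ?thesis using columns_Fd.det_nonzero by simp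
qed

text \<open>The adjugate formula shows each entry to be a quotient of polynomials, which yields its
  Laurent expansion. The second formula is R_F F_d = F_s.\<close>

lemma rational_matrix_eq:
  assumes z: "poly (Determinant.det Fd) z \<noteq> 0"
  shows "i < p \<Longrightarrow> j < p \<Longrightarrow> rational_matrix F z $$ (i, j)
      = (\<Sum>k<p. poly (Fs $$ (i, k)) z * poly (adj_mat Fd $$ (k, j)) z) / poly (Determinant.det Fd) z"
    and "i < p \<Longrightarrow> k < p \<Longrightarrow> (\<Sum>j<p. rational_matrix F z $$ (i, j) * poly (Fd $$ (j, k)) z) = poly (Fs $$ (i, k)) z"
proof -
  have hom: "comm_ring_hom (\<lambda>f. poly f z :: complex)" "semiring_hom (\<lambda>f. poly f z :: complex)"
    by (unfold_locales; simp)+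
  define E where "E = eval_mat_poly Fd z"
  define A where "A = eval_mat_poly (adj_mat Fd) z"
  define \<delta> where "\<delta> = poly (Determinant.det Fd) z"
  have E: "E \<in> carrier_mat p p" using Fd_carrier by (simp add: E_def eval_mat_poly_def)
  have A: "A \<in> carrier_mat p p" using adj_mat(1)[OF Fd_carrier] by (simp add: A_def eval_mat_poly_def)
  have Fsz: "eval_mat_poly Fs z \<in> carrier_mat p p" using Fs_carrier by (simp add: eval_mat_poly_def)
  have "Determinant.det E = \<delta>" 
    unfolding E_def eval_mat_poly_def \<delta>_def by (rule comm_ring_hom.hom_det[OF hom(1)])
  then have "E \<in> Units (ring_mat TYPE(complex) p ())"
    using z by (intro det_non_zero_imp_unit[OF E]) (simp add: \<delta>_def)
  then obtain B where inv: "mat_inverse E = Some B"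
    using mat_inverse(1)[OF E, of "()"] by (cases "mat_inverse E") auto
  then have B: "E * B = 1\<^sub>m p" "B * E = 1\<^sub>m p" "B \<in> carrier_mat p p"
    using mat_inverse(2)[OF E] by auto
  have R: "rational_matrix F z = eval_mat_poly Fs z * B"
    using inv by (simp add: rational_matrix_def E_def)
  have "A * E = \<delta> \<cdot>\<^sub>m 1\<^sub>m p"
  proof -
    have "A * E = eval_mat_poly (adj_mat Fd * Fd) z"
      unfolding A_def E_def eval_mat_poly_def
      by (rule semiring_hom.mat_hom_mult[OF hom(2) adj_mat(1)[OF Fd_carrier] Fd_carrier, symmetric])
    also have "\<dots> = \<delta> \<cdot>\<^sub>m 1\<^sub>m p"
      unfolding adj_mat(3)[OF Fd_carrier] by (intro eq_matI) (auto simp: eval_mat_poly_def \<delta>_def)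
    finally show ?thesis .
  qed
  then have "(A * E) * B = \<delta> \<cdot>\<^sub>m B" 
    using B(3) mult_smult_assoc_mat[OF one_carrier_mat B(3)] by simp
  then have AB: "A = \<delta> \<cdot>\<^sub>m B" using assoc_mult_mat[OF A E B(3)] B(1) A by simp
  show "rational_matrix F z $$ (i, j)
      = (\<Sum>k<p. poly (Fs $$ (i, k)) z * poly (adj_mat Fd $$ (k, j)) z) / poly (Determinant.det Fd) z"
    if ij: "i < p" "j < p" for i j
  proof -
    have adj: "poly (adj_mat Fd $$ (k, j)) z = \<delta> * B $$ (k, j)" if "k < p" for k
    proof -
      have "poly (adj_mat Fd $$ (k, j)) z = A $$ (k, j)"
        using that ij adj_mat(1)[OF Fd_carrier] by (simp add: A_def eval_mat_poly_def)
      then show ?thesis using that ij B(3) by (simp add: AB)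
    qed
    have "rational_matrix F z $$ (i, j) = (\<Sum>k<p. poly (Fs $$ (i, k)) z * B $$ (k, j))"
      using ij B(3) Fs_carrier
      by (auto simp: R scalar_prod_def lessThan_atLeast0 eval_mat_poly_def intro!: sum.cong)
    then show ?thesis
      using z by (simp add: adj \<delta>_def[symmetric] mult.left_commute sum_distrib_left[symmetric])
  qed
  show "(\<Sum>j<p. rational_matrix F z $$ (i, j) * poly (Fd $$ (j, k)) z) = poly (Fs $$ (i, k)) z"
    if ik: "i < p" "k < p" for i k
  proof -
    define Q where "Q = eval_mat_poly Fs z * B"
    have Q: "Q \<in> carrier_mat p p" using Fsz B(3) by (simp add: Q_def)
    have "(\<Sum>j<p. rational_matrix F z $$ (i, j) * poly (Fd $$ (j, k)) z) = (Q * E) $$ (i, k)"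
      using ik E Q Fd_carrier unfolding R Q_def[symmetric]
      by (auto simp: scalar_prod_def lessThan_atLeast0 E_def eval_mat_poly_def intro!: sum.cong)
    also have "Q * E = eval_mat_poly Fs z"
      unfolding Q_def
      using assoc_mult_mat[OF Fsz B(3) E] B(2) Fsz by simp
    finally show ?thesis using ik Fs_carrier by (simp add: eval_mat_poly_def)
  qed
qed

section \<open>Laurent expansion and properness of R_F at infinity\<close>

definition markov_fls :: "nat \<Rightarrow> nat \<Rightarrow> complex fls" where
  "markov_fls i j = laurent_expansion (\<lambda>w. rational_matrix F (1 / w) $$ (i, j)) 0"

lemma eventually_det_Fd: "eventually (\<lambda>w. poly (Determinant.det Fd) (1 / w) \<noteq> 0) (at 0)"
  using has_laurent_expansion_nonzero_imp_eventually_nonzero[OF fls_at_infinity_expansion]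
    det_Fd_nonzero fls_at_infinity_eq_0_iff by blast

lemma markov_fls_expansion:
  assumes ij: "i < p" "j < p"
  shows "(\<lambda>w. rational_matrix F (1 / w) $$ (i, j)) has_laurent_expansion markov_fls i j"
proof -
  define G where "G = (\<Sum>k<p. fls_at_infinity (Fs $$ (i, k)) * fls_at_infinity (adj_mat Fd $$ (k, j)))
      / fls_at_infinity (Determinant.det Fd)"
  have "(\<lambda>w. (\<Sum>k<p. poly (Fs $$ (i, k)) (1 / w) * poly (adj_mat Fd $$ (k, j)) (1 / w))
      / poly (Determinant.det Fd) (1 / w)) has_laurent_expansion G"
    unfolding G_def by (intro laurent_expansion_intros fls_at_infinity_expansion)
  moreover have ev: "eventually (\<lambda>w. rational_matrix F (1 / w) $$ (i, j) =
      (\<Sum>k<p. poly (Fs $$ (i, k)) (1 / w) * poly (adj_mat Fd $$ (k, j)) (1 / w))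
      / poly (Determinant.det Fd) (1 / w)) (at 0)"
    using eventually_det_Fd by eventually_elim (simp add: rational_matrix_eq(1) ij)
  ultimately have "(\<lambda>w. rational_matrix F (1 / w) $$ (i, j)) has_laurent_expansion G"
    by (intro iffD2[OF has_laurent_expansion_cong[OF ev refl]])
  then show ?thesis
    unfolding markov_fls_def using laurent_expansion_0_eqI by simp
qed

lemma markov_index: "i < p \<Longrightarrow> j < p \<Longrightarrow> markov F k $$ (i, j) = (-1) ^ k * fls_nth (markov_fls i j) (int k)"
  using F by (simp add: markov_def markov_fls_def)

lemma markov_carrier: "markov F k \<in> carrier_mat p p"
  using F by (simp add: markov_def)

lemma markov_fls_times_Fd:
  assumes ik: "i < p" "k < p"
  shows "(\<Sum>j<p. markov_fls i j * fls_at_infinity (Fd $$ (j, k))) = fls_at_infinity (Fs $$ (i, k))"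
proof (rule has_laurent_expansion_unique)
  show "(\<lambda>w. \<Sum>j<p. rational_matrix F (1 / w) $$ (i, j) * poly (Fd $$ (j, k)) (1 / w))
      has_laurent_expansion (\<Sum>j<p. markov_fls i j * fls_at_infinity (Fd $$ (j, k)))"
    using ik by (intro laurent_expansion_intros fls_at_infinity_expansion markov_fls_expansion) auto
  have "eventually (\<lambda>w. (\<Sum>j<p. rational_matrix F (1 / w) $$ (i, j) * poly (Fd $$ (j, k)) (1 / w))
      = poly (Fs $$ (i, k)) (1 / w)) (at 0)"
    using eventually_det_Fd by eventually_elim (simp add: rational_matrix_eq(2) ik)
  then show "(\<lambda>w. \<Sum>j<p. rational_matrix F (1 / w) $$ (i, j) * poly (Fd $$ (j, k)) (1 / w))
      has_laurent_expansion fls_at_infinity (Fs $$ (i, k))"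
    by (rule iffD2[OF has_laurent_expansion_cong[OF _ refl]]) (rule fls_at_infinity_expansion)
qed

text \<open>Suppose the lowest index in row i of R_F is M < 0, first attained in column k, and let d
  be the degree of column k of F_d. In column k of R_F F_d = F_s, triangularity leaves one nonzero
  term at \<lambda>^(d - M), a degree that F_s does not reach.\<close>

lemma markov_fls_nonneg:
  assumes i: "i < p" and j: "j < p" and m: "m < 0"
  shows "fls_nth (markov_fls i j) m = 0"
proof (rule ccontr)
  assume nz: "fls_nth (markov_fls i j) m \<noteq> 0"
  define K where "K = {k. k < p \<and> markov_fls i k \<noteq> 0}"
  have "markov_fls i j \<noteq> 0" using nz by auto
  then have K: "finite K" "j \<in> K" using j by (auto simp: K_def)
  define M where "M = Min ((\<lambda>k. fls_subdegree (markov_fls i k)) ` K)"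
  have M_le: "M \<le> fls_subdegree (markov_fls i k)" if "k \<in> K" for k
    unfolding M_def using K that by (intro Min_le) auto
  have below: "fls_nth (markov_fls i k) t = 0" if "k < p" "t < M" for k t
  proof (cases "k \<in> K")
    case True
    then show ?thesis using M_le[OF True] that by (intro fls_eq0_below_subdegree) simp
  next
    case False
    then show ?thesis using that by (simp add: K_def)
  qed
  have "\<not> m < M" using below[OF j] nz by auto
  then have M_neg: "M < 0" using m by simp
  have "M \<in> (\<lambda>k. fls_subdegree (markov_fls i k)) ` K"
    unfolding M_def using K by (intro Min_in) auto
  then have ex: "\<exists>k. k < p \<and> fls_nth (markov_fls i k) M \<noteq> 0"
    by (auto simp: K_def)
  define k where "k = (LEAST k. k < p \<and> fls_nth (markov_fls i k) M \<noteq> 0)"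
  have k: "k < p" "fls_nth (markov_fls i k) M \<noteq> 0"
    using LeastI_ex[OF ex] by (auto simp: k_def)
  have k_least: "fls_nth (markov_fls i l) M = 0" if "l < k" for l
    using not_less_Least[of l "\<lambda>k. k < p \<and> fls_nth (markov_fls i k) M \<noteq> 0"] that k(1) by (auto simp: k_def)
  define d where "d = cdeg F k div 2"
  have summand: "fls_nth (markov_fls i l * fls_at_infinity (Fd $$ (l, k))) (M - int d)
      = fls_nth (markov_fls i l) M * coeff (F $$ (l, k)) (cdeg F k)" if l: "l < p" for l
  proof -
    have "fls_nth (markov_fls i l * fls_at_infinity (Fd $$ (l, k))) (M - int d)
        = (\<Sum>n\<le>d. fls_nth (markov_fls i l) (M - int d + int n) * coeff (Fd $$ (l, k)) n)"
      using degree_Fd[OF l k(1)] by (intro fls_nth_times_at_infinity) (simp add: d_def)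
    also have "\<dots> = (\<Sum>n\<le>d. if n = d then fls_nth (markov_fls i l) M * coeff (Fd $$ (l, k)) d else 0)"
      using below[OF l] by (intro sum.cong) auto
    also have "\<dots> = fls_nth (markov_fls i l) M * coeff (F $$ (l, k)) (cdeg F k)"
      using coeff_Fd_top[OF l k(1)] by (simp add: d_def)
    finally show ?thesis .
  qed
  have "fls_nth (fls_at_infinity (Fs $$ (i, k))) (M - int d)
      = (\<Sum>l<p. fls_nth (markov_fls i l) M * coeff (F $$ (l, k)) (cdeg F k))"
    using summand unfolding markov_fls_times_Fd[OF i k(1), symmetric] fls_nth_sum by simp
  also have "\<dots> = (\<Sum>l<p. if l = k then fls_nth (markov_fls i k) M * coeff (F $$ (k, k)) (cdeg F k) else 0)"
    using k_least lower_coeff by (intro sum.cong refl) (metis lessThan_iff linorder_neqE_nat mult_zero_left mult_zero_right)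
  also have "\<dots> \<noteq> 0" using k diag_coeff by simp
  finally have "coeff (Fs $$ (i, k)) (nat (int d - M)) \<noteq> 0"
    using M_neg by (simp add: fls_nth_at_infinity)
  moreover have "degree (Fs $$ (i, k)) < nat (int d - M)"
    using degree_Fs[OF i k(1)] M_neg by (simp add: d_def)
  ultimately show False by (simp add: coeff_eq_0)
qed

text \<open>In the variable \<open>\<lambda>\<close>: \<open>F = Dm + Sm\<close>, where column \<open>k\<close> of \<open>Dm\<close> has the parity of the column
  degree, and \<open>W(\<lambda>) = R\<^sub>F(\<lambda>\<^sup>2) / \<lambda>\<close> satisfies \<open>W Dm = Sm\<close>.\<close>

definition Dm :: "nat \<Rightarrow> nat \<Rightarrow> complex poly" where
  "Dm i k = (if even (cdeg F k) then 1 else [:0, 1:]) * pcompose (Fd $$ (i, k)) (monom 1 2)"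

definition Sm :: "nat \<Rightarrow> nat \<Rightarrow> complex poly" where
  "Sm i k = (if even (cdeg F k) then [:0, 1:] * pcompose (odd_part (F $$ (i, k))) (monom 1 2)
     else pcompose (even_part (F $$ (i, k))) (monom 1 2))"

definition W :: "nat \<Rightarrow> nat \<Rightarrow> complex fls" where
  "W i j = fls_X * fls_compose_power (markov_fls i j) 2"

text \<open>Index 1 in w = 1/\<lambda> is the coefficient of 1/\<lambda>.\<close>

definition L :: "nat \<Rightarrow> nat \<Rightarrow> complex poly \<Rightarrow> complex" where
  "L i j f = fls_nth (W i j * fls_at_infinity f) 1"

lemma F_split: "i < p \<Longrightarrow> k < p \<Longrightarrow> F $$ (i, k) = Dm i k + Sm i k"
  using even_odd_decomposition[of "F $$ (i, k)" "even_part (F $$ (i, k))" "odd_part (F $$ (i, k))"] F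
  by (cases "even (cdeg F k)") (simp_all add: Dm_def Sm_def dominant_part_def add.commute)

lemma coeff_Dm:
  assumes "i < p" "k < p"
  shows "coeff (Dm i k) n = (if even n = even (cdeg F k) then coeff (F $$ (i, k)) n else 0)"
proof (cases "even (cdeg F k)")
  case True
  then show ?thesis
    using assms by (auto simp: Dm_def coeff_pcompose_square coeff_Fd elim!: evenE)
next
  case False
  then have "cdeg F k mod 2 = 1" by (simp add: odd_iff_mod_2_eq_one)
  then show ?thesis
    using assms False
    by (cases n) (auto simp: Dm_def coeff_pcompose_square coeff_Fd coeff_pCons simp del: coeff_pcompose_0 elim!: evenE)
qed

lemma W_times_Dm:
  assumes "i < p" "k < p"
  shows "(\<Sum>j<p. W i j * fls_at_infinity (Dm j k)) = fls_at_infinity (Sm i k)"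
proof -
  have R: "(\<Sum>j<p. fls_compose_power (markov_fls i j) 2 * fls_at_infinity (pcompose (Fd $$ (j, k)) (monom 1 2)))
      = fls_at_infinity (pcompose (Fs $$ (i, k)) (monom 1 2))"
  proof -
    have "(\<Sum>j<p. fls_compose_power (markov_fls i j) 2 * fls_at_infinity (pcompose (Fd $$ (j, k)) (monom 1 2)))
        = fls_compose_power (\<Sum>j<p. markov_fls i j * fls_at_infinity (Fd $$ (j, k))) 2"
      by (induction p) (simp_all add: fls_at_infinity_square)
    then show ?thesis
      by (simp add: markov_fls_times_Fd[OF assms] fls_at_infinity_square)
  qed
  show ?thesis
  proof (cases "even (cdeg F k)")
    case True
    \<comment> \<open>In an even column F_s has a factor \<lambda>, which becomes \<lambda>^2 after
      the substitution; the factor 1/\<lambda> of W leaves one of them.\<close>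
    have "Fs $$ (i, k) = [:0, 1:] * odd_part (F $$ (i, k))"
      using True assms F by (simp add: subordinated_part_def)
    then have "pcompose (Fs $$ (i, k)) (monom 1 2)
        = [:0, 1:] * ([:0, 1:] * pcompose (odd_part (F $$ (i, k))) (monom 1 2))"
      by (simp add: pcompose_mult pcompose_pCons monom_altdef power2_eq_square)
    then have "fls_X * fls_at_infinity (pcompose (Fs $$ (i, k)) (monom 1 2)) = fls_at_infinity (Sm i k)"
      using True by (simp only: fls_X_times_at_infinity_X) (simp add: Sm_def)
    then show ?thesis
      using True by (simp add: W_def Dm_def mult.assoc sum_distrib_left[symmetric] R)
  next
    case False
    \<comment> \<open>In an odd column the factor 1/\<lambda> of W cancels the extra \<lambda> in
      \<open>Dm\<close>.\<close>
    have "fls_X * fls_at_infinity (Dm j k) = fls_at_infinity (pcompose (Fd $$ (j, k)) (monom 1 2))" for j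
      using False fls_X_times_at_infinity_X by (simp add: Dm_def)
    then have "W i j * fls_at_infinity (Dm j k)
        = fls_compose_power (markov_fls i j) 2 * fls_at_infinity (pcompose (Fd $$ (j, k)) (monom 1 2))" for j
      unfolding W_def by (metis mult.assoc mult.commute)
    then have "(\<Sum>j<p. W i j * fls_at_infinity (Dm j k))
        = (\<Sum>j<p. fls_compose_power (markov_fls i j) 2 * fls_at_infinity (pcompose (Fd $$ (j, k)) (monom 1 2)))"
      by simp
    then show ?thesis
      using False assms F unfolding R by (simp add: Sm_def subordinated_part_def)
  qed
qed

text \<open>W is the sum of the terms (-1)^k s_k \<lambda>^(-2k-1): it is odd, and it vanishes at
  infinity because R_F is proper.\<close>

lemma W_nth:
  assumes "i < p" "j < p"
  shows "fls_nth (W i j) (1 + int n) = (if even n then (-1) ^ (n div 2) * markov F (n div 2) $$ (i, j) else 0)"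
    and "m \<le> 0 \<Longrightarrow> fls_nth (W i j) m = 0"
proof -
  have eq: "fls_nth (W i j) m = (if even (m - 1) then fls_nth (markov_fls i j) ((m - 1) div 2) else 0)" for m
    by (simp add: W_def fls_X_times_conv_shift fls_nth_compose_power)
  show "fls_nth (W i j) (1 + int n) = (if even n then (-1) ^ (n div 2) * markov F (n div 2) $$ (i, j) else 0)"
    unfolding eq markov_index[OF assms] by (auto elim!: evenE simp flip: power_add)
  show "fls_nth (W i j) m = 0" if "m \<le> 0"
    unfolding eq using markov_fls_nonneg[OF assms] that by auto
qed

lemma L_eq:
  assumes "degree f \<le> d"
  shows "L i j f = (\<Sum>n\<le>d. fls_nth (W i j) (1 + int n) * coeff f n)"
  unfolding L_def by (rule fls_nth_times_at_infinity[OF assms])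

text \<open>With h = W (D(\<lambda>) - D(\<mu>))/(\<lambda> - \<mu>), one has (\<lambda> - \<mu>) h
  = S - W D(\<mu>). As W has only negative powers of \<lambda>, the coefficients of h down to that
  of 1/\<lambda> follow Horner's scheme for S, which ends with S(\<mu>) at 1/\<lambda>.\<close>

lemma poly_Sm_eq:
  assumes ik: "i < p" "k < p"
  shows "poly (Sm i k) \<mu> = (\<Sum>j<p. L i j (synthetic_div (Dm j k) \<mu>))"
proof -
  define h where "h = (\<Sum>j<p. W i j * fls_at_infinity (synthetic_div (Dm j k) \<mu>))"
  have h: "fls_nth h 1 = (\<Sum>j<p. L i j (synthetic_div (Dm j k) \<mu>))"
    by (simp add: h_def L_def fls_nth_sum)
  have "fls_X_inv * h = fls_const \<mu> * h + fls_at_infinity (Sm i k) - (\<Sum>j<p. W i j * fls_const (poly (Dm j k) \<mu>))"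
  proof -
    have synth: "fls_X_inv * fls_at_infinity (synthetic_div (Dm j k) \<mu>)
        = fls_const \<mu> * fls_at_infinity (synthetic_div (Dm j k) \<mu>) + fls_at_infinity (Dm j k) - fls_const (poly (Dm j k) \<mu>)" for j
    proof -
      have "[:0, 1:] * synthetic_div (Dm j k) \<mu> + [:poly (Dm j k) \<mu>:] = smult \<mu> (synthetic_div (Dm j k) \<mu>) + Dm j k"
        using synthetic_div_correct'[of \<mu> "Dm j k"] by (simp add: algebra_simps)
      then have "fls_at_infinity ([:0, 1:] * synthetic_div (Dm j k) \<mu> + [:poly (Dm j k) \<mu>:])
          = fls_at_infinity (smult \<mu> (synthetic_div (Dm j k) \<mu>) + Dm j k)" by simp
      then show ?thesis
        unfolding fls_at_infinity_add fls_at_infinity_mult fls_at_infinity_X fls_at_infinity_const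
          fls_at_infinity_smult by (simp add: eq_diff_eq)
    qed
    have "fls_X_inv * h = (\<Sum>j<p. W i j * (fls_X_inv * fls_at_infinity (synthetic_div (Dm j k) \<mu>)))"
      by (simp add: h_def sum_distrib_left mult_ac)
    also have "\<dots> = fls_const \<mu> * h + (\<Sum>j<p. W i j * fls_at_infinity (Dm j k)) - (\<Sum>j<p. W i j * fls_const (poly (Dm j k) \<mu>))"
      unfolding synth
      by (simp add: h_def algebra_simps sum.distrib sum_subtractf sum_distrib_left)
    finally show ?thesis by (simp add: W_times_Dm ik)
  qed
  then have rec: "fls_nth (fls_X_inv * h) m = fls_nth (fls_const \<mu> * h + fls_at_infinity (Sm i k)
      - (\<Sum>j<p. W i j * fls_const (poly (Dm j k) \<mu>))) m" for m by simp
  have step: "fls_nth h (1 - int n) = \<mu> * fls_nth h (1 - int (Suc n)) + coeff (Sm i k) n" for n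
    using rec[of "- int n"] W_nth(2)[of i _ "- int n"] ik
    by (simp add: fls_X_inv_times_conv_shift fls_nth_at_infinity fls_nth_sum mult.commute[of _ "fls_const _"])
  have partial: "fls_nth h 1 = (\<Sum>n<t. coeff (Sm i k) n * \<mu> ^ n) + \<mu> ^ t * fls_nth h (1 - int t)" for t
  proof (induction t)
    case (Suc t)
    show ?case unfolding Suc step[of t] by (simp add: algebra_simps)
  qed simp
  \<comment> \<open>Large enough to exhaust the coefficients of S and the polynomial part of
    h.\<close>
  define t where "t = Suc (degree (Sm i k)) + nat (1 - fls_subdegree h) + 1"
  have "fls_nth h (1 - int t) = 0"
    by (rule fls_eq0_below_subdegree) (simp add: t_def)
  then have "fls_nth h 1 = (\<Sum>n<t. coeff (Sm i k) n * \<mu> ^ n)"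
    using partial[of t] by simp
  also have "\<dots> = (\<Sum>n\<le>degree (Sm i k). coeff (Sm i k) n * \<mu> ^ n)"
    by (intro sum.mono_neutral_right) (auto simp: t_def coeff_eq_0)
  finally show ?thesis by (simp add: h poly_altdef)
qed

sublocale functional: column_functional p "cdeg F" Dm L Sm
proof
  fix i k assume i: "i < p"
  show "coeff (Dm i k) (cdeg F k) = 0" if "k < i"
    using that i coeff_Dm[of i k] lower_coeff[of i k] by simp
  assume k: "k < p"
  show "degree (Dm i k) \<le> cdeg F k"
    using degree_le_cdeg[OF i, of k] i k by (intro degree_le) (auto simp: coeff_Dm coeff_eq_0)
  show "(\<Sum>j<p. L i j (g * Dm j k)) = 0" for g
  proof -
    have "(\<Sum>j<p. L i j (g * Dm j k)) = fls_nth (fls_at_infinity g * (\<Sum>j<p. W i j * fls_at_infinity (Dm j k))) 1"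
      by (simp add: L_def fls_nth_sum sum_distrib_left fls_at_infinity_mult mult_ac)
    then show ?thesis
      by (simp add: W_times_Dm i k fls_nth_at_infinity flip: fls_at_infinity_mult)
  qed
  show "poly (Sm i k) \<mu> = (\<Sum>j<p. L i j (synthetic_div (Dm j k) \<mu>))" for \<mu>
    by (rule poly_Sm_eq[OF i k])
next
  show "coeff (Dm k k) (cdeg F k) \<noteq> 0" if "k < p" for k
    using that by (simp add: coeff_Dm diag_coeff)
  show "L i j (f + g) = L i j f + L i j g" for i j f g
    by (simp add: L_def fls_at_infinity_add distrib_left)
  show "L i j (smult c f) = c * L i j f" for i j c f
    by (simp add: L_def fls_at_infinity_smult mult.left_commute)
qed

text \<open>An even n up to \<open>2 * l + 1\<close> has \<open>n div 2 \<le> l\<close>, and odd n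
  contribute nothing, so the Hermitian Markov parameters cover all degrees that the reduction to low
  degree asks for.\<close>

lemma hermitian_functional:
  assumes herm: "\<And>k. k \<le> l \<Longrightarrow> hermitian (markov F k)" and l: "\<And>k. k < p \<Longrightarrow> cdeg F k \<le> l + 1"
  shows functional.hermitian_functional
proof (rule functional.hermitian_functional_if_low_degree[OF _ l])
  fix i j and f :: "complex poly" assume ij: "i < p" "j < p" and f: "degree f \<le> 2 * l + 1"
  have w: "fls_nth (W i j) (1 + int n) * ((-1) ^ n * cnj (coeff f n))
      = cnj (fls_nth (W j i) (1 + int n) * coeff f n)" if n: "n \<le> 2 * l + 1" for n
  proof (cases "even n")
    case True
    have "markov F (n div 2) $$ (i, j) = cnj (markov F (n div 2) $$ (j, i))"
      using herm[of "n div 2", unfolded hermitian_iff[OF markov_carrier], rule_format, OF _ ij(2,1)] n by simp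
    then show ?thesis
      using True unfolding W_nth(1)[OF ij] W_nth(1)[OF ij(2,1)] by simp
  next
    case False
    then show ?thesis unfolding W_nth(1)[OF ij] W_nth(1)[OF ij(2,1)] by simp
  qed
  have "L i j (para f) = (\<Sum>n\<le>2 * l + 1. fls_nth (W i j) (1 + int n) * ((-1) ^ n * cnj (coeff f n)))"
    using f by (subst L_eq[of _ "2 * l + 1"]) (simp_all only: degree_para coeff_para)
  also have "\<dots> = cnj (\<Sum>n\<le>2 * l + 1. fls_nth (W j i) (1 + int n) * coeff f n)"
    unfolding cnj_sum using w by (intro sum.cong) auto
  finally show "L i j (para f) = cnj (L j i f)"
    by (simp only: L_eq[OF f])
qed

section \<open>Hurwitz stability as positivity of the form\<close>

lemma hurwitz_stable_iff:
  "hurwitz_stable F \<longleftrightarrow> (\<forall>\<mu> x k. functional.closed_loop \<mu> x \<longrightarrow> k < p \<longrightarrow> x k \<noteq> 0 \<longrightarrow> Re \<mu> < 0)"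
proof -
  have loop: "functional.closed_loop \<mu> x \<longleftrightarrow> eval_mat_poly F \<mu> *\<^sub>v vec p x = 0\<^sub>v p" for \<mu> x
  proof -
    have dims: "eval_mat_poly F \<mu> \<in> carrier_mat p p" using F by (simp add: eval_mat_poly_def)
    have "(eval_mat_poly F \<mu> *\<^sub>v vec p x) $ i = (\<Sum>k<p. (poly (Dm i k) \<mu> + poly (Sm i k) \<mu>) * x k)"
      if i: "i < p" for i
      using i F by (auto simp: eval_mat_poly_def scalar_prod_def lessThan_atLeast0 F_split intro!: sum.cong)
    then show ?thesis
      using dims by (auto simp: functional.closed_loop_def vec_eq_iff)
  qed
  have det: "poly (Determinant.det F) \<mu> = 0 \<longleftrightarrow> (\<exists>x. functional.closed_loop \<mu> x \<and> (\<exists>k<p. x k \<noteq> 0))" for \<mu>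
  proof -
    have hom: "comm_ring_hom (\<lambda>f. poly f \<mu> :: complex)" by unfold_locales auto
    have dims: "eval_mat_poly F \<mu> \<in> carrier_mat p p" using F by (simp add: eval_mat_poly_def)
    have "poly (Determinant.det F) \<mu> = Determinant.det (eval_mat_poly F \<mu>)"
      unfolding eval_mat_poly_def by (rule comm_ring_hom.hom_det[OF hom, symmetric])
    then have "poly (Determinant.det F) \<mu> = 0
        \<longleftrightarrow> (\<exists>v. v \<in> carrier_vec p \<and> v \<noteq> 0\<^sub>v p \<and> eval_mat_poly F \<mu> *\<^sub>v v = 0\<^sub>v p)"
      using det_0_iff_vec_prod_zero[OF dims] by simp
    also have "\<dots> \<longleftrightarrow> (\<exists>x. functional.closed_loop \<mu> x \<and> (\<exists>k<p. x k \<noteq> 0))"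
    proof
      assume "\<exists>v. v \<in> carrier_vec p \<and> v \<noteq> 0\<^sub>v p \<and> eval_mat_poly F \<mu> *\<^sub>v v = 0\<^sub>v p"
      then obtain v where v: "v \<in> carrier_vec p" "v \<noteq> 0\<^sub>v p" "eval_mat_poly F \<mu> *\<^sub>v v = 0\<^sub>v p" by blast
      have "vec p (\<lambda>k. v $ k) = v" using v(1) by auto
      moreover have "\<exists>k<p. v $ k \<noteq> 0"
      proof (rule ccontr)
        assume "\<not> ?thesis"
        then have "v = 0\<^sub>v p" using v(1) by (intro eq_vecI) auto
        then show False using v(2) by simp
      qed
      ultimately show "\<exists>x. functional.closed_loop \<mu> x \<and> (\<exists>k<p. x k \<noteq> 0)"
        using v(3) loop by (intro exI[of _ "\<lambda>k. v $ k"]) auto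
    next
      assume "\<exists>x. functional.closed_loop \<mu> x \<and> (\<exists>k<p. x k \<noteq> 0)"
      then obtain x k where x: "functional.closed_loop \<mu> x" "k < p" "x k \<noteq> 0" by blast
      have "vec p x \<noteq> 0\<^sub>v p"
      proof
        assume "vec p x = 0\<^sub>v p"
        then have "vec p x $ k = 0" using x(2) by simp
        then show False using x by simp
      qed
      then show "\<exists>v. v \<in> carrier_vec p \<and> v \<noteq> 0\<^sub>v p \<and> eval_mat_poly F \<mu> *\<^sub>v v = 0\<^sub>v p"
        using x(1) loop by (intro exI[of _ "vec p x"]) auto
    qed
    finally show ?thesis .
  qed
  have "regular F" using F det_F_nonzero by (auto simp: regular_def)
  then show ?thesis unfolding hurwitz_stable_def det by blast
qed

lemma stable_iff_form_positive:
  assumes h: functional.hermitian_functional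
  shows "hurwitz_stable F \<longleftrightarrow>
    (\<forall>u. functional.small u \<longrightarrow> (\<exists>j<p. u j \<noteq> 0) \<longrightarrow> 0 < Re (functional.form u u))"
proof
  assume "hurwitz_stable F"
  then have stable: "Re \<mu> < 0" if "functional.closed_loop \<mu> x" "k < p" "x k \<noteq> 0" for \<mu> x k
    using that hurwitz_stable_iff by blast
  \<comment> \<open>Column k of D has the parity of \<open>cdeg F k\<close>, and column k of S has
    the opposite one.\<close>
  define \<sigma> :: "nat \<Rightarrow> complex" where "\<sigma> k = (-1) ^ cdeg F k" for k
  show "\<forall>u. functional.small u \<longrightarrow> (\<exists>j<p. u j \<noteq> 0) \<longrightarrow> 0 < Re (functional.form u u)"
  proof (intro allI impI, elim exE conjE)
    fix u j assume u: "functional.small u" "j < p" "u j \<noteq> 0"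
    show "0 < Re (functional.form u u)"
    proof (rule functional.form_positive_if_stable[OF h _ _ _ _ u, where \<sigma> = \<sigma>])
      show "poly (Dm i k) (- \<mu>) * \<sigma> k = poly (Dm i k) \<mu>" for i k \<mu>
        by (simp add: Dm_def \<sigma>_def poly_pcompose poly_monom)
      show "poly (Sm i k) (- \<mu>) * \<sigma> k = - poly (Sm i k) \<mu>" for i k \<mu>
        by (simp add: Sm_def \<sigma>_def poly_pcompose poly_monom)
    qed (use stable in \<open>auto simp: \<sigma>_def\<close>)
  qed
next
  assume pos: "\<forall>u. functional.small u \<longrightarrow> (\<exists>j<p. u j \<noteq> 0) \<longrightarrow> 0 < Re (functional.form u u)"
  show "hurwitz_stable F"
    unfolding hurwitz_stable_iff
  proof (intro allI impI)
    fix \<mu> x k assume x: "functional.closed_loop \<mu> x" "k < p" "x k \<noteq> 0"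
    show "Re \<mu> < 0"
      by (rule functional.stable_if_form_positive[OF h _ x]) (use pos in blast)
  qed
qed

section \<open>The form in coordinates: block Hankel matrices\<close>

lemma index_set_eq: "index_set F (int n) = {k. k < p \<and> 2 * n + 1 < cdeg F k}"
  using F by (auto simp: index_set_def cdeg_Fd)

text \<open>The shift by one for odd columns makes both parities fit one condition: \<lambda>^(2n)
  is a remainder monomial in row k. The plain index sets do the same for \<lambda>^(2n+1).\<close>

lemma index_set_tilde_eq: "index_set_tilde F n = {k. k < p \<and> 2 * n < cdeg F k}"
proof -
  have "k \<in> index_set_tilde F n \<longleftrightarrow> k < p \<and> 2 * n < cdeg F k" for k
    using F by (cases "even (cdeg F k)") (auto simp: index_set_tilde_def index_set_def cdeg_Fd elim!: evenE oddE)
  then show ?thesis by auto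
qed

definition blocks_0 :: nat where
  "blocks_0 = (if all_cdeg_even F then half_deg F else half_deg F + 1)"

definition J0 :: "(nat \<times> nat) set" where
  "J0 = (SIGMA n:{..<blocks_0}. index_set_tilde F n)"

definition J1 :: "(nat \<times> nat) set" where
  "J1 = (SIGMA n:{..<half_deg F}. index_set F (int n))"

definition Q0 :: "(nat \<times> nat \<Rightarrow> complex) \<Rightarrow> complex" where
  "Q0 x = (\<Sum>(m, i)\<in>J0. \<Sum>(n, j)\<in>J0. cnj (x (m, i)) * markov F (m + n) $$ (i, j) * x (n, j))"

definition Q1 :: "(nat \<times> nat \<Rightarrow> complex) \<Rightarrow> complex" where
  "Q1 x = (\<Sum>(m, i)\<in>J1. \<Sum>(n, j)\<in>J1. cnj (x (m, i)) * markov F (m + n + 1) $$ (i, j) * x (n, j))"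

lemma cdeg_le_mdeg: "k < p \<Longrightarrow> cdeg F k \<le> mdeg F"
  unfolding mdeg_def using F by (intro Max_ge) auto

text \<open>The blocks reach every remainder monomial: exponents 2n and 2n+1 below the column degree
  have n < \<open>blocks_0\<close> and n < \<open>half_deg F\<close>, respectively.\<close>

lemma cdeg_le_blocks:
  assumes k: "k < p"
  shows "cdeg F k \<le> 2 * blocks_0" and "cdeg F k \<le> 2 * half_deg F + 1"
proof -
  show "cdeg F k \<le> 2 * half_deg F + 1"
    using cdeg_le_mdeg[OF k] by (simp add: half_deg_def)
  moreover have "cdeg F k \<noteq> 2 * half_deg F + 1" if "all_cdeg_even F"
    using that F k by (auto simp: all_cdeg_even_def)
  ultimately show "cdeg F k \<le> 2 * blocks_0"
    by (auto simp: blocks_0_def)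
qed

lemma positive_definite_hankel_0_iff:
  assumes "\<And>k. k \<le> markov_last F \<Longrightarrow> hermitian (markov F k)"
  shows "positive_definite (hankel_0 F) \<longleftrightarrow> (\<forall>x. (\<exists>s\<in>J0. x s \<noteq> 0) \<longrightarrow> 0 < Re (Q0 x))"
  unfolding hankel_0_def blocks_0_def[symmetric] J0_def Q0_def
  using assms markov_carrier
  by (intro positive_definite_block_hankel_iff[of "markov F" p])
     (auto simp: index_set_tilde_eq blocks_0_def markov_last_def split: if_splits)

lemma positive_definite_hankel_1_iff:
  assumes "\<And>k. k \<le> markov_last F \<Longrightarrow> hermitian (markov F k)"
  shows "positive_definite (hankel_1 F) \<longleftrightarrow> (\<forall>x. (\<exists>s\<in>J1. x s \<noteq> 0) \<longrightarrow> 0 < Re (Q1 x))"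
  unfolding hankel_1_def J1_def Q1_def
proof (rule positive_definite_block_hankel_iff[of "\<lambda>k. markov F (k + 1)" p])
  fix i j assume "i < half_deg F" "j < half_deg F"
  then have "i + j + 1 \<le> 2 * half_deg F - 1" by linarith
  also have "\<dots> \<le> markov_last F" by (simp add: markov_last_def)
  finally show "hermitian (markov F (i + j + 1))" by (rule assms)
qed (auto simp: index_set_eq markov_carrier)

definition T :: "(nat \<times> nat) set" where
  "T = (SIGMA i:{..<p}. {..<cdeg F i})"

text \<open>The Gram matrix of the form in the monomial basis, with the sign from
  \<open>para\<close>. Indices are (row, exponent), whereas \<open>J0\<close> and \<open>J1\<close>
  consist of pairs (block, row).\<close>

definition coeff_kernel :: "nat \<times> nat \<Rightarrow> nat \<times> nat \<Rightarrow> complex" where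
  "coeff_kernel s t = (-1) ^ snd s * fls_nth (W (fst s) (fst t)) (1 + int (snd s + snd t))"

lemma form_eq_kernel:
  assumes u: "functional.small u"
  shows "functional.form u u = (\<Sum>s\<in>T. \<Sum>t\<in>T.
    cnj (coeff (u (fst s)) (snd s)) * coeff_kernel s t * coeff (u (fst t)) (snd t))"
proof -
  have u_eq: "u i = (\<Sum>a<cdeg F i. monom (coeff (u i) a) a)" if "i < p" for i
  proof (rule poly_eqI)
    fix n
    show "coeff (u i) n = coeff (\<Sum>a<cdeg F i. monom (coeff (u i) a) a) n"
      using u that by (auto simp: functional.small_def coeff_sum not_less)
  qed
  have L_monom: "L i j (monom c n) = c * fls_nth (W i j) (1 + int n)" for i j c n
  proof -
    have "L i j (monom c n) = (\<Sum>m\<le>n. fls_nth (W i j) (1 + int m) * coeff (monom c n) m)"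
      by (rule L_eq) (rule degree_monom_le)
    also have "\<dots> = (\<Sum>m\<le>n. if m = n then fls_nth (W i j) (1 + int n) * c else 0)"
      by (intro sum.cong) auto
    finally show ?thesis by simp
  qed
  have para_monom: "para (monom c n) = monom ((-1) ^ n * cnj c) n" for c n
    by (rule poly_eqI) (simp add: coeff_para)
  have summand: "L i j (para (u i) * u j) = (\<Sum>a<cdeg F i. \<Sum>b<cdeg F j.
      cnj (coeff (u i) a) * coeff_kernel (i, a) (j, b) * coeff (u j) b)" if "i < p" "j < p" for i j
  proof -
    have "L i j (para (u i) * u j) = L i j ((\<Sum>a<cdeg F i. para (monom (coeff (u i) a) a))
        * (\<Sum>b<cdeg F j. monom (coeff (u j) b) b))"
      using u_eq[OF that(1)] u_eq[OF that(2)] para_sum by metis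
    then show ?thesis
      unfolding sum_product functional.L_sum para_monom mult_monom L_monom coeff_kernel_def
      by (simp add: mult_ac)
  qed
  have sum_T: "(\<Sum>s\<in>T. f s) = (\<Sum>i<p. \<Sum>a<cdeg F i. f (i, a))" for f :: "nat \<times> nat \<Rightarrow> complex"
    by (simp add: T_def sum.Sigma)
  have "functional.form u u = (\<Sum>i<p. \<Sum>j<p. \<Sum>a<cdeg F i. \<Sum>b<cdeg F j.
      cnj (coeff (u i) a) * coeff_kernel (i, a) (j, b) * coeff (u j) b)"
    unfolding functional.form_def using summand by (intro sum.cong) auto
  also have "\<dots> = (\<Sum>i<p. \<Sum>a<cdeg F i. \<Sum>j<p. \<Sum>b<cdeg F j.
      cnj (coeff (u i) a) * coeff_kernel (i, a) (j, b) * coeff (u j) b)"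
    by (intro sum.cong refl sum.swap)
  finally show ?thesis by (simp only: sum_T fst_conv snd_conv)
qed

text \<open>The signs \<open>(-1)\<^sup>n\<close> absorb those of \<open>para\<close> and of the expansion of \<open>R\<^sub>F\<close>.\<close>

definition even_coeffs :: "(nat \<Rightarrow> complex poly) \<Rightarrow> nat \<times> nat \<Rightarrow> complex" where
  "even_coeffs u s = (-1) ^ fst s * coeff (u (snd s)) (2 * fst s)"

definition odd_coeffs :: "(nat \<Rightarrow> complex poly) \<Rightarrow> nat \<times> nat \<Rightarrow> complex" where
  "odd_coeffs u s = (-1) ^ fst s * coeff (u (snd s)) (2 * fst s + 1)"

text \<open>Since W is odd, monomials whose exponents differ in parity are orthogonal. Exponents 2a
  and 2b meet s_(a+b), while 2a+1 and 2b+1 meet s_(a+b+1).\<close>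

lemma form_eq_hankel:
  assumes u: "functional.small u"
  shows "functional.form u u = Q0 (even_coeffs u) + Q1 (odd_coeffs u)"
proof -
  define T0 where "T0 = {s \<in> T. even (snd s)}"
  define T1 where "T1 = {s \<in> T. odd (snd s)}"
  have T: "T = T0 \<union> T1" "T0 \<inter> T1 = {}" "finite T0" "finite T1"
    by (auto simp: T0_def T1_def T_def)
  define X where "X s t = cnj (coeff (u (fst s)) (snd s)) * coeff_kernel s t * coeff (u (fst t)) (snd t)" for s t
  have X0: "X s t = 0" if "s \<in> T" "t \<in> T" "odd (snd s + snd t)" for s t
  proof -
    have "fst s < p" "fst t < p" using that by (auto simp: T_def)
    then show ?thesis
      using that(3) W_nth(1)[of "fst s" "fst t" "snd s + snd t"] by (simp add: X_def coeff_kernel_def)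
  qed
  have sum_T: "(\<Sum>s\<in>T. f s) = (\<Sum>s\<in>T0. f s) + (\<Sum>s\<in>T1. f s)" for f :: "nat \<times> nat \<Rightarrow> complex"
    unfolding T(1) by (rule sum.union_disjoint[OF T(3,4,2)])
  have "(\<Sum>s\<in>T0. \<Sum>t\<in>T1. X s t) = 0" "(\<Sum>s\<in>T1. \<Sum>t\<in>T0. X s t) = 0"
    by (auto intro!: sum.neutral X0 simp: T0_def T1_def)
  then have split: "functional.form u u = (\<Sum>s\<in>T0. \<Sum>t\<in>T0. X s t) + (\<Sum>s\<in>T1. \<Sum>t\<in>T1. X s t)"
    unfolding form_eq_kernel[OF u] X_def[symmetric] by (simp add: sum_T sum.distrib)
  define e where "e s = (snd s, 2 * fst s)" for s :: "nat \<times> nat"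
  define d where "d s = (snd s, 2 * fst s + 1)" for s :: "nat \<times> nat"
  have e: "bij_betw e J0 T0"
    unfolding bij_betw_def
  proof
    show "inj_on e J0" by (auto simp: inj_on_def e_def)
    show "e ` J0 = T0"
    proof
      show "e ` J0 \<subseteq> T0" by (auto simp: e_def J0_def T0_def T_def index_set_tilde_eq)
      show "T0 \<subseteq> e ` J0"
      proof
        fix s assume s: "s \<in> T0"
        then obtain n where n: "s = (fst s, 2 * n)" by (cases s) (auto simp: T0_def elim!: evenE)
        have "fst s < p" "2 * n < cdeg F (fst s)" using s n by (auto simp: T0_def T_def)
        then have "(n, fst s) \<in> J0"
          using cdeg_le_blocks(1)[of "fst s"] by (auto simp: J0_def index_set_tilde_eq)
        then show "s \<in> e ` J0" using n by (intro image_eqI[of _ _ "(n, fst s)"]) (auto simp: e_def)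
      qed
    qed
  qed
  have d: "bij_betw d J1 T1"
    unfolding bij_betw_def
  proof
    show "inj_on d J1" by (auto simp: inj_on_def d_def)
    show "d ` J1 = T1"
    proof
      show "d ` J1 \<subseteq> T1" by (auto simp: d_def J1_def T1_def T_def index_set_eq)
      show "T1 \<subseteq> d ` J1"
      proof
        fix s assume s: "s \<in> T1"
        then obtain n where n: "s = (fst s, 2 * n + 1)" by (cases s) (auto simp: T1_def elim!: oddE)
        have "fst s < p" "2 * n + 1 < cdeg F (fst s)" using s n by (auto simp: T1_def T_def)
        then have "(n, fst s) \<in> J1"
          using cdeg_le_blocks(2)[of "fst s"] by (auto simp: J1_def index_set_eq)
        then show "s \<in> d ` J1" using n by (intro image_eqI[of _ _ "(n, fst s)"]) (auto simp: d_def)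
      qed
    qed
  qed
  have Xe: "X (e s) (e t) = cnj (even_coeffs u s) * markov F (fst s + fst t) $$ (snd s, snd t) * even_coeffs u t"
    if "s \<in> J0" "t \<in> J0" for s t
  proof -
    have p: "snd s < p" "snd t < p" using that by (auto simp: J0_def index_set_tilde_eq)
    have "2 * fst s + 2 * fst t = 2 * (fst s + fst t)" by simp
    then have "fls_nth (W (snd s) (snd t)) (1 + int (2 * fst s + 2 * fst t))
        = (-1) ^ (fst s + fst t) * markov F (fst s + fst t) $$ (snd s, snd t)"
      using W_nth(1)[OF p, of "2 * (fst s + fst t)"]
      by (metis dvd_triv_left nonzero_mult_div_cancel_left zero_neq_numeral)
    then show ?thesis
      unfolding X_def e_def coeff_kernel_def even_coeffs_def fst_conv snd_conv by (simp add: power_add)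
  qed
  have Xd: "X (d s) (d t) = cnj (odd_coeffs u s) * markov F (fst s + fst t + 1) $$ (snd s, snd t) * odd_coeffs u t"
    if "s \<in> J1" "t \<in> J1" for s t
  proof -
    have p: "snd s < p" "snd t < p" using that by (auto simp: J1_def index_set_eq)
    have "2 * fst s + 1 + (2 * fst t + 1) = 2 * (fst s + fst t + 1)" by simp
    then have "fls_nth (W (snd s) (snd t)) (1 + int (2 * fst s + 1 + (2 * fst t + 1)))
        = (-1) ^ (fst s + fst t + 1) * markov F (fst s + fst t + 1) $$ (snd s, snd t)"
      using W_nth(1)[OF p, of "2 * (fst s + fst t + 1)"]
      by (metis dvd_triv_left nonzero_mult_div_cancel_left zero_neq_numeral)
    \<comment> \<open>For odd exponents \<open>para\<close> contributes a factor -1, which cancels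
      the additional sign in \<open>(-1) ^ (a + b + 1)\<close>.\<close>
    then show ?thesis
      unfolding X_def d_def coeff_kernel_def odd_coeffs_def fst_conv snd_conv by (simp add: power_add)
  qed
  have "(\<Sum>s\<in>T0. \<Sum>t\<in>T0. X s t) = (\<Sum>s\<in>J0. \<Sum>t\<in>J0. X (e s) (e t))"
    by (simp add: sum.reindex_bij_betw[OF e, symmetric])
  also have "\<dots> = Q0 (even_coeffs u)"
    unfolding Q0_def by (intro sum.cong refl) (auto simp: Xe intro!: sum.cong)
  finally have 0: "(\<Sum>s\<in>T0. \<Sum>t\<in>T0. X s t) = Q0 (even_coeffs u)" .
  have "(\<Sum>s\<in>T1. \<Sum>t\<in>T1. X s t) = (\<Sum>s\<in>J1. \<Sum>t\<in>J1. X (d s) (d t))"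
    by (simp add: sum.reindex_bij_betw[OF d, symmetric])
  also have "\<dots> = Q1 (odd_coeffs u)"
    unfolding Q1_def by (intro sum.cong refl) (auto simp: Xd intro!: sum.cong)
  finally show ?thesis using 0 split by simp
qed

lemma Q0_zero: "(\<And>s. s \<in> J0 \<Longrightarrow> x s = 0) \<Longrightarrow> Q0 x = 0"
  by (auto simp: Q0_def intro!: sum.neutral)

lemma Q1_zero: "(\<And>s. s \<in> J1 \<Longrightarrow> x s = 0) \<Longrightarrow> Q1 x = 0"
  by (auto simp: Q1_def intro!: sum.neutral)

lemma Q0_cong: "(\<And>s. s \<in> J0 \<Longrightarrow> x s = y s) \<Longrightarrow> Q0 x = Q0 y"
  by (auto simp: Q0_def intro!: sum.cong)

lemma Q1_cong: "(\<And>s. s \<in> J1 \<Longrightarrow> x s = y s) \<Longrightarrow> Q1 x = Q1 y"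
  by (auto simp: Q1_def intro!: sum.cong)

text \<open>Both coordinate vectors can be prescribed independently. Hence each Hankel form can be
  tested alone, with the other vector set to 0.\<close>

lemma exists_small:
  "\<exists>u. functional.small u \<and> (\<forall>s\<in>J0. even_coeffs u s = x s) \<and> (\<forall>s\<in>J1. odd_coeffs u s = y s)"
proof -
  define c where "c i n = (if even n then (-1) ^ (n div 2) * x (n div 2, i)
    else (-1) ^ (n div 2) * y (n div 2, i))" for i n
  define u where "u i = (\<Sum>n<cdeg F i. monom (c i n) n)" for i
  have coeff_u: "coeff (u i) n = (if n < cdeg F i then c i n else 0)" for i n
    by (simp add: u_def coeff_sum)
  show ?thesis
  proof (intro exI[of _ u] conjI ballI)
    show "functional.small u" by (simp add: functional.small_def coeff_u)
    show "even_coeffs u s = x s" if "s \<in> J0" for s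
      using that by (auto simp: even_coeffs_def J0_def index_set_tilde_eq coeff_u c_def simp flip: power_add mult.assoc)
    show "odd_coeffs u s = y s" if "s \<in> J1" for s
      using that by (auto simp: odd_coeffs_def J1_def index_set_eq coeff_u c_def simp flip: power_add mult.assoc)
  qed
qed

lemma form_positive_iff:
  "(\<forall>u. functional.small u \<longrightarrow> (\<exists>j<p. u j \<noteq> 0) \<longrightarrow> 0 < Re (functional.form u u)) \<longleftrightarrow>
    (\<forall>x. (\<exists>s\<in>J0. x s \<noteq> 0) \<longrightarrow> 0 < Re (Q0 x)) \<and> (\<forall>x. (\<exists>s\<in>J1. x s \<noteq> 0) \<longrightarrow> 0 < Re (Q1 x))"
proof
  assume pos: "\<forall>u. functional.small u \<longrightarrow> (\<exists>j<p. u j \<noteq> 0) \<longrightarrow> 0 < Re (functional.form u u)"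
  have *: "0 < Re (Q0 x + Q1 y)" if nz: "(\<exists>s\<in>J0. x s \<noteq> 0) \<or> (\<exists>s\<in>J1. y s \<noteq> 0)" for x y
  proof -
    obtain u where u: "functional.small u" "\<forall>s\<in>J0. even_coeffs u s = x s" "\<forall>s\<in>J1. odd_coeffs u s = y s"
      using exists_small by blast
    have "\<exists>j<p. u j \<noteq> 0"
    proof (rule ccontr)
      assume "\<not> ?thesis"
      then have "even_coeffs u s = 0" if "s \<in> J0" for s
        using that by (auto simp: even_coeffs_def J0_def index_set_tilde_eq)
      moreover have "odd_coeffs u s = 0" if "s \<in> J1" for s
        using that \<open>\<not> (\<exists>j<p. u j \<noteq> 0)\<close> by (auto simp: odd_coeffs_def J1_def index_set_eq)
      ultimately show False using u(2,3) nz by auto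
    qed
    moreover have "Q0 (even_coeffs u) = Q0 x" "Q1 (odd_coeffs u) = Q1 y"
      using u(2,3) by (auto intro!: Q0_cong Q1_cong)
    ultimately show ?thesis using pos u(1) form_eq_hankel[OF u(1)] by metis
  qed
  show "(\<forall>x. (\<exists>s\<in>J0. x s \<noteq> 0) \<longrightarrow> 0 < Re (Q0 x)) \<and> (\<forall>x. (\<exists>s\<in>J1. x s \<noteq> 0) \<longrightarrow> 0 < Re (Q1 x))"
    using *[of _ "\<lambda>_. 0"] *[of "\<lambda>_. 0"] by (simp add: Q0_zero Q1_zero)
next
  assume pos: "(\<forall>x. (\<exists>s\<in>J0. x s \<noteq> 0) \<longrightarrow> 0 < Re (Q0 x)) \<and> (\<forall>x. (\<exists>s\<in>J1. x s \<noteq> 0) \<longrightarrow> 0 < Re (Q1 x))"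
  show "\<forall>u. functional.small u \<longrightarrow> (\<exists>j<p. u j \<noteq> 0) \<longrightarrow> 0 < Re (functional.form u u)"
  proof (intro allI impI, elim exE conjE)
    fix u j assume u: "functional.small u" "j < p" "u j \<noteq> 0"
    have Q0: "0 \<le> Re (Q0 x)" "\<exists>s\<in>J0. x s \<noteq> 0 \<Longrightarrow> 0 < Re (Q0 x)" for x
      using pos Q0_zero[of x] by (cases "\<exists>s\<in>J0. x s \<noteq> 0"; force)+
    have Q1: "0 \<le> Re (Q1 x)" "\<exists>s\<in>J1. x s \<noteq> 0 \<Longrightarrow> 0 < Re (Q1 x)" for x
      using pos Q1_zero[of x] by (cases "\<exists>s\<in>J1. x s \<noteq> 0"; force)+
    obtain n where n: "coeff (u j) n \<noteq> 0" using u(3) by (auto simp: poly_eq_iff)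
    then have nN: "n < cdeg F j" using u(1,2) by (auto simp: functional.small_def not_less[symmetric])
    have "(\<exists>s\<in>J0. even_coeffs u s \<noteq> 0) \<or> (\<exists>s\<in>J1. odd_coeffs u s \<noteq> 0)"
    proof (cases "even n")
      case True
      then obtain m where m: "n = 2 * m" by (rule evenE)
      then have "(m, j) \<in> J0" "even_coeffs u (m, j) \<noteq> 0"
        using n nN u(2) cdeg_le_blocks(1)[OF u(2)] by (auto simp: J0_def index_set_tilde_eq even_coeffs_def)
      then show ?thesis by blast
    next
      case False
      then obtain m where m: "n = 2 * m + 1" by (rule oddE)
      then have "(m, j) \<in> J1" "odd_coeffs u (m, j) \<noteq> 0"
        using n nN u(2) cdeg_le_blocks(2)[OF u(2)] by (auto simp: J1_def index_set_eq odd_coeffs_def)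
      then show ?thesis by blast
    qed
    then have "0 < Re (Q0 (even_coeffs u)) + Re (Q1 (odd_coeffs u))"
    proof
      assume "\<exists>s\<in>J0. even_coeffs u s \<noteq> 0"
      then show ?thesis by (intro add_pos_nonneg Q0(2) Q1(1))
    next
      assume "\<exists>s\<in>J1. odd_coeffs u s \<noteq> 0"
      then show ?thesis by (intro add_nonneg_pos Q0(1) Q1(2))
    qed
    then show "0 < Re (functional.form u u)"
      by (simp add: form_eq_hankel[OF u(1)])
  qed
qed

end

theorem theorem4p8:
  fixes F :: "complex poly mat" and p :: nat
  assumes "p \<ge> 1" and "F \<in> carrier_mat p p"
    and "mdeg F \<noteq> 0"
    and "column_reduced F"
    and "upper_triangular (hcdc F)"
    and "\<And>k. k \<le> markov_last F \<Longrightarrow> hermitian (markov F k)"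
  shows "hurwitz_stable F \<longleftrightarrow> positive_definite (hankel_0 F) \<and> positive_definite (hankel_1 F)"
proof -
  interpret triangular_mat_poly F p
    using assms by unfold_locales auto
  \<comment> \<open>Let m be \<open>half_deg F\<close>. If all column degrees are even, they are at
    most 2m and l = 2m - 1; otherwise they are at most 2m + 1 and l = 2m.\<close>
  have "cdeg F k \<le> markov_last F + 1" if k: "k < p" for k
  proof (cases "all_cdeg_even F")
    case True
    have "mdeg F \<in> {cdeg F k |k. k < dim_col F}"
      unfolding mdeg_def using assms(2) k by (intro Max_in) auto
    then have "even (mdeg F)" using True by (auto simp: all_cdeg_even_def)
    then show ?thesis
      using cdeg_le_mdeg[OF k] assms(3) True by (auto simp: markov_last_def half_deg_def elim!: evenE)
  next
    case False
    then show ?thesis using cdeg_le_blocks(2)[OF k] by (simp add: markov_last_def)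
  qed
  then have "functional.hermitian_functional"
    using assms(6) by (intro hermitian_functional[of "markov_last F"]) auto
  then show ?thesis
    using stable_iff_form_positive form_positive_iff
      positive_definite_hankel_0_iff[OF assms(6)] positive_definite_hankel_1_iff[OF assms(6)] by simp
qed

end
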